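(* Consider the changepoint double array described in the context, suppose (post-change separation) that $F_{P_0}$ and $H$ are continuous, $H(0)=0$, and $\sup_{t\in[0,1]}|H(t)-t|>0$, and let $w_{T_n+1}>0$. Suppose $\Pi$ puts mass $v_f>0$ at a betting density $f$, where $\log f$ is bounded and Lipschitz and $I_f(H):=\int_0^1\log f(u)\,dH(u)>0$. Let $\mathcal C_{n,w,f}(b_n):=\mathcal B_{n,w}(b_n)+\log(1/v_f)$. If $\mathcal C_{n,w,f}(b_n)\to\infty$ and $\mathcal C_{n,w,f}(b_n)=o(T_n)$, then, for every $A>1/I_f(H)$, $$\mathbb P_{P_0,T_n,P_1}\{\tau_{n,S,w}(b_n)\le T_n+A\,\mathcal C_{n,w,f}(b_n)\}\to1,$$ and the same statement holds for $\tau_{n,Z,w}(b_n)$. If in addition $\liminf_nq_{n,w}(b_n)>0$, then $$\mathbb P_{P_0,T_n,P_1}\{\tau_{n,Z,w}(b_n)>T_n+A\,\mathcal C_{n,w,f}(b_n)\mid\tau_{n,Z,w}(b_n)>T_n\}\to0$$ and $$\liminf_{n\to\infty}\mathbb P_{P_0,T_n,P_1}\{T_n<\tau_{n,Z,w}(b_n)\le T_n+A\,\mathcal C_{n,w,f}(b_n)\}\ge\liminf_{n\to\infty}q_{n,w}(b_n),$$ with the same conclusions for $\tau_{n,S,w}(b_n)$.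
   Context: Data: $(T_n)_{n\ge1}$ is an increasing sequence of positive integers with $T_n\to\infty$; $P_0,P_1$ are probability measures on $\mathbb R$. For each $n$, the row $(X_{n,j})_{j\ge1}$ satisfies $X_{n,1},\dots,X_{n,T_n}\stackrel{iid}{\sim}P_0$, $X_{n,T_n+1},X_{n,T_n+2},\dots\stackrel{iid}{\sim}P_1$, the two blocks being independent; randomizers $\lambda_{n,j}\stackrel{iid}{\sim}U(0,1)$ are independent of the array. $\mathbb P_{P_0,T_n,P_1}$ is the law of row $n$ together with its randomizers. Conformal p-values: $p_{n,j}:=\frac1j\big(\sum_{i=1}^j\mathbf 1\{X_{n,i}<X_{n,j}\}+\lambda_{n,j}\sum_{i=1}^j\mathbf 1\{X_{n,i}=X_{n,j}\}\big)$. Detectors: $\mathcal F$ is a (jointly measurably parametrized) family of probability densities on $[0,1]$, $\Pi$ a probability measure on (the parameter space of) $\mathcal F$, $w=(w_k)_{k\ge1}$ a deterministic nonnegative weight sequence, $b_n>0$ deterministic thresholds. For $k\le t$, $M_{n,k,t}:=\int_{\mathcal F}\prod_{j=k}^t f(p_{n,j})\,d\Pi(f)$, $S_{n,t}^{(w)}:=\sum_{k=1}^tw_kM_{n,k,t}$, $Z_{n,t}^{(w)}:=\max_{1\le k\le t}w_kM_{n,k,t}$, $\tau_{n,S,w}(b):=\inf\{t\ge1:S_{n,t}^{(w)}\ge b\}$, $\tau_{n,Z,w}(b):=\inf\{t\ge1:Z_{n,t}^{(w)}\ge b\}$ ($\inf\varnothing=\infty$). Put $W_t:=\sum_{k=1}^tw_k$,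 $\mathcal B_{n,w}(b_n):=\log\frac{b_n}{w_{T_n+1}}$, $q_{n,w}(b_n):=1-\min\{1,W_{T_n}/b_n\}$. $F_{P_0}$ is the CDF of $P_0$ and $H(t):=\mathbb P_{Y\sim P_1}\{F_{P_0}(Y)\le t\}$, $t\in[0,1]$. *)

theory Defs
  imports "HOL-Probability.Probability" "HOL-Library.Landau_Symbols"
begin

text \<open>
  One row of the changepoint array on an arbitrary probability space. Observations \<open>X j\<close> and
  randomizers \<open>U j\<close> are indexed by \<open>j \<ge> 1\<close>. The single independence condition over the disjoint
  sum of the two index sets says that all of them are mutually independent.
\<close>

definition changepoint_row ::
  "'a measure \<Rightarrow> real measure \<Rightarrow> nat \<Rightarrow> real measure \<Rightarrow>
     (nat \<Rightarrow> 'a \<Rightarrow> real) \<Rightarrow> (nat \<Rightarrow> 'a \<Rightarrow> real) \<Rightarrow> bool" where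
  "changepoint_row M P0 T P1 X U \<longleftrightarrow>
     prob_space M \<and>
     prob_space.indep_vars M (\<lambda>_. borel) (case_sum X U) ({1..} <+> {1..}) \<and>
     (\<forall>j\<ge>1. distr M borel (X j) = (if j \<le> T then P0 else P1)) \<and>
     (\<forall>j\<ge>1. distr M borel (U j) = uniform_measure lborel {0..1})"

definition conformal_p :: "(nat \<Rightarrow> real) \<Rightarrow> (nat \<Rightarrow> real) \<Rightarrow> nat \<Rightarrow> real" where
  "conformal_p x u j =
     (1 / real j) * ((\<Sum>i=1..j. of_bool (x i < x j)) + u j * (\<Sum>i=1..j. of_bool (x i = x j)))"

definition density_on_unit :: "(real \<Rightarrow> real) \<Rightarrow> bool" where
  "density_on_unit g \<longleftrightarrow>
     g \<in> borel_measurable borel \<and> (\<forall>u\<in>{0..1}. 0 \<le> g u) \<and>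
     (\<integral>\<^sup>+u\<in>{0..1}. ennreal (g u) \<partial>lborel) = 1"

text \<open>
  A family of densities on \<open>[0,1]\<close> parametrized by the points of a probability space \<open>\<mu>\<close>.
  Densities are Borel functions on the whole line whose values off \<open>[0,1]\<close> are irrelevant: the
  conformal p-values lie in \<open>[0,1]\<close> only almost surely when the randomizers are arbitrary random
  variables with the uniform law, and measurability on the line keeps all events below measurable.
\<close>

definition density_family :: "'b measure \<Rightarrow> ('b \<Rightarrow> real \<Rightarrow> real) \<Rightarrow> bool" where
  "density_family \<mu> d \<longleftrightarrow>
     prob_space \<mu> \<and>
     (\<lambda>(\<theta>, u). d \<theta> u) \<in> borel_measurable (\<mu> \<Otimes>\<^sub>M borel) \<and>
     (\<forall>\<theta>\<in>space \<mu>. density_on_unit (d \<theta>))"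

text \<open>
  The mass of \<open>\<mu>\<close> at a density \<open>f\<close> on \<open>[0,1]\<close>; for an injective parametrization this is the mass
  of a single parameter.
\<close>

definition mass_at :: "'b measure \<Rightarrow> ('b \<Rightarrow> real \<Rightarrow> real) \<Rightarrow> (real \<Rightarrow> real) \<Rightarrow> real" where
  "mass_at \<mu> d f = measure \<mu> {\<theta> \<in> space \<mu>. \<forall>u\<in>{0..1}. d \<theta> u = f u}"

text \<open>
  The mixture integral is extended-valued: it need not be finite for every sequence \<open>p\<close>.
\<close>

definition mixture_M ::
  "'b measure \<Rightarrow> ('b \<Rightarrow> real \<Rightarrow> real) \<Rightarrow> (nat \<Rightarrow> real) \<Rightarrow> nat \<Rightarrow> nat \<Rightarrow> ennreal" where
  "mixture_M \<mu> d p k t = (\<integral>\<^sup>+\<theta>. (\<Prod>j=k..t. ennreal (d \<theta> (p j))) \<partial>\<mu>)"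

definition stat_S ::
  "'b measure \<Rightarrow> ('b \<Rightarrow> real \<Rightarrow> real) \<Rightarrow> (nat \<Rightarrow> real) \<Rightarrow> (nat \<Rightarrow> real) \<Rightarrow> nat \<Rightarrow> ennreal" where
  "stat_S \<mu> d w p t = (\<Sum>k=1..t. ennreal (w k) * mixture_M \<mu> d p k t)"

definition stat_Z ::
  "'b measure \<Rightarrow> ('b \<Rightarrow> real \<Rightarrow> real) \<Rightarrow> (nat \<Rightarrow> real) \<Rightarrow> (nat \<Rightarrow> real) \<Rightarrow> nat \<Rightarrow> ennreal" where
  "stat_Z \<mu> d w p t = (MAX k\<in>{1..t}. ennreal (w k) * mixture_M \<mu> d p k t)"

text \<open>In \<open>enat\<close> the infimum of the empty set is \<open>\<infinity>\<close>.\<close>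

definition tau_S ::
  "'b measure \<Rightarrow> ('b \<Rightarrow> real \<Rightarrow> real) \<Rightarrow> (nat \<Rightarrow> real) \<Rightarrow> real \<Rightarrow> (nat \<Rightarrow> real) \<Rightarrow> enat" where
  "tau_S \<mu> d w b p = (INF t\<in>{t. 1 \<le> t \<and> stat_S \<mu> d w p t \<ge> ennreal b}. enat t)"

definition tau_Z ::
  "'b measure \<Rightarrow> ('b \<Rightarrow> real \<Rightarrow> real) \<Rightarrow> (nat \<Rightarrow> real) \<Rightarrow> real \<Rightarrow> (nat \<Rightarrow> real) \<Rightarrow> enat" where
  "tau_Z \<mu> d w b p = (INF t\<in>{t. 1 \<le> t \<and> stat_Z \<mu> d w p t \<ge> ennreal b}. enat t)"

definition cum_weight :: "(nat \<Rightarrow> real) \<Rightarrow> nat \<Rightarrow> real" where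
  "cum_weight w t = (\<Sum>k=1..t. w k)"

definition barrier :: "(nat \<Rightarrow> real) \<Rightarrow> nat \<Rightarrow> real \<Rightarrow> real" where
  "barrier w T b = ln (b / w (T + 1))"

definition barrier_at :: "(nat \<Rightarrow> real) \<Rightarrow> nat \<Rightarrow> real \<Rightarrow> real \<Rightarrow> real" where
  "barrier_at w T b v = barrier w T b + ln (1 / v)"

definition survival_bound :: "(nat \<Rightarrow> real) \<Rightarrow> nat \<Rightarrow> real \<Rightarrow> real" where
  "survival_bound w T b = 1 - min 1 (cum_weight w T / b)"

definition post_H :: "real measure \<Rightarrow> real measure \<Rightarrow> real \<Rightarrow> real" where
  "post_H P0 P1 t = \<P>(y in P1. cdf P0 y \<le> t)"

text \<open>
  The integral of \<open>log f\<close> over \<open>[0,1]\<close> against the Lebesgue-Stieltjes measure of \<open>H\<close>.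
\<close>

definition growth_rate :: "(real \<Rightarrow> real) \<Rightarrow> (real \<Rightarrow> real) \<Rightarrow> real" where
  "growth_rate f H = (LINT u:{0..1}|interval_measure H. ln (f u))"

end

theory Submission
  imports Defs
begin

text \<open>
  For detection, \<open>Z\<close> at time \<open>T + m\<close> dominates the single term \<open>k = T + 1\<close>, and the mixture in
  that term dominates the mass at \<open>f\<close> times the betting wealth of \<open>f\<close> alone. Over a window of
  length \<open>m = o(T)\<close> the post-change p-values are uniformly close to \<open>F\<^sub>P\<^sub>0 (X\<^sub>j)\<close>, which are independent with distribution
  function \<open>H\<close>; Hoeffding's inequality is used for both approximations, so the log-wealth grows
  at a rate close to \<open>I\<^sub>f(H)\<close>.

  For survival, the first \<open>T\<close> p-values are independent and uniform, hence \<open>S - W\<close> is a martingale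
  up to time \<open>T\<close> and Ville's inequality bounds the probability of an early stop.
\<close>

subsection \<open>Independence and uniformity of the pre-change p-values\<close>

text \<open>The exact law before the change comes from exchangeability: in a sample without ties a
  uniformly chosen position has a uniform randomized rank, and no symmetric function of the sample
  can tell which position is the last. Continuity of \<open>cdf P0\<close> is what rules out ties.
  After the change this is lost. All p-values are ranks in one common sample, hence dependent, and
  that sample is contaminated by post-change points. This forces the short window: discarding the
  contamination moves a p-value by at most \<open>m / T\<close>, and once \<open>X j\<close> and
  \<open>U j\<close> are fixed the remaining part of the rank is a sum of \<open>T\<close>
  independent terms. A union bound over the window costs a factor \<open>m\<close>, harmless against
  an error exponentially small in \<open>T\<close>, and the Lipschitz property of
  \<open>ln f\<close> passes these errors on to the log-wealth. The surplus \<open>I - 1 / A\<close>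
  of the growth rate over the required rate pays for all of them. Since \<open>Z\<close> is at most
  \<open>S\<close>, \<open>S\<close> stops no later than \<open>Z\<close>. Hence detection is proved
  for \<open>Z\<close> and survival for \<open>S\<close>, and each transfers to the other
  statistic.\<close>

abbreviation unif :: "real measure" where
  "unif \<equiv> uniform_measure lborel {0..1}"

text \<open>The ranked position \<open>i\<close> is separated from the sample size \<open>n\<close>
  so that a permutation can move it, and the randomizer is a bare number \<open>v\<close> so that it
  can be integrated out.\<close>

definition rank_p :: "nat \<Rightarrow> (nat \<Rightarrow> real) \<Rightarrow> nat \<Rightarrow> real \<Rightarrow> real" where
  "rank_p n x i v =
     (1 / real n) * ((\<Sum>k=1..n. of_bool (x k < x i)) + v * (\<Sum>k=1..n. of_bool (x k = x i)))"

lemma conformal_p_eq_rank_p: "conformal_p x u j = rank_p j x j (u j)"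
  by (simp add: conformal_p_def rank_p_def)

lemma prob_space_unif: "prob_space unif"
  by (rule prob_space_uniform_measure) (auto simp: emeasure_lborel_Icc_eq)

lemma sets_unif [measurable_cong]: "sets unif = sets borel"
  by simp

lemma nn_integral_unif:
  assumes [measurable]: "h \<in> borel_measurable borel"
  shows "(\<integral>\<^sup>+v. h v \<partial>unif) = (\<integral>\<^sup>+v. h v * indicator {0..1} v \<partial>lborel)"
  by (subst nn_integral_uniform_measure) (auto simp: divide_ennreal_def)

text \<open>In a sample without ties, the observation with \<open>m\<close> smaller ones has rank
  \<open>(m + v) / n\<close>. Its randomizer spreads it evenly over one cell of the grid of mesh
  \<open>1 / n\<close>, and the factor \<open>n\<close> is the Jacobian.\<close>

lemma nn_integral_unif_affine:
  assumes [measurable]: "h \<in> borel_measurable borel" and n: "n \<ge> 1"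
  shows "(\<integral>\<^sup>+v. h ((real m + v) / real n) \<partial>unif) =
    ennreal n * (\<integral>\<^sup>+y. h y * indicator {m / n..Suc m / n} y \<partial>lborel)"
proof -
  have n0: "real n > 0" using n by simp
  have *: "(m + v) / real n = m / n + (1 / n) * v" for v :: real
    by (simp add: add_divide_distrib)
  have ind: "indicator {m / n..Suc m / n} (m / n + (1 / n) * v) = (indicator {0..1} v :: ennreal)" for v :: real
    using n0 by (auto simp: indicator_def field_simps)
  have "(\<integral>\<^sup>+v. h ((real m + v) / real n) \<partial>unif) = (\<integral>\<^sup>+v. h (m / n + (1 / n) * v) * indicator {0..1} v \<partial>lborel)"
    unfolding * by (rule nn_integral_unif) simp
  moreover have "(\<integral>\<^sup>+y. h y * indicator {m / n..Suc m / n} y \<partial>lborel) =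
      ennreal (1 / n) * (\<integral>\<^sup>+v. h (m / n + (1 / n) * v) * indicator {0..1} v \<partial>lborel)"
    using nn_integral_real_affine[of "\<lambda>y. h y * indicator {m / n..Suc m / n} y" "1 / n" "m / n"] n0
    unfolding ind by simp
  ultimately show ?thesis
    using n0 by (simp add: mult.assoc[symmetric] ennreal_mult[symmetric])
qed

lemma sum_nn_integral_unif_affine:
  assumes [measurable]: "h \<in> borel_measurable borel" and n: "n \<ge> 1"
  shows "(\<Sum>m<n. \<integral>\<^sup>+v. h ((real m + v) / real n) \<partial>unif) = ennreal n * (\<integral>\<^sup>+v. h v \<partial>unif)"
proof -
  have n0: "real n > 0" using n by simp
  \<comment> \<open>Induction on the number \<open>k\<close> of cells while the mesh stays
    \<open>1 / n\<close>. Adjacent closed cells share an endpoint, so the indicators add up only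
    almost everywhere.\<close>
  have "(\<Sum>m<k. \<integral>\<^sup>+y. h y * indicator {m / n..Suc m / n} y \<partial>lborel) =
      (\<integral>\<^sup>+y. h y * indicator {0..k / n} y \<partial>lborel)" for k
  proof (induction k)
    case 0
    have "AE y::real in lborel. y \<noteq> 0" by (rule AE_lborel_singleton)
    then have "AE y in lborel. h y * indicator {0..real 0 / n} y = 0"
      by eventually_elim auto
    then show ?case by (simp add: nn_integral_0_iff_AE)
  next
    case (Suc k)
    have "AE y::real in lborel. y \<noteq> k / n" by (rule AE_lborel_singleton)
    then have "AE y in lborel. h y * indicator {0..Suc k / n} y =
      h y * indicator {0..k / n} y + h y * indicator {k / n..Suc k / n} y"
    proof eventually_elim
      fix y assume y: "y \<noteq> k / n"
      have ind: "indicator {0..b} y = indicator {0..a} y + (indicator {a..b} y :: ennreal)"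
        if "0 \<le> a" "a \<le> b" "y \<noteq> a" for a b
        using that by (auto simp: indicator_def)
      have "0 \<le> k / n" "k / n \<le> Suc k / n" using n0 by (auto intro: divide_right_mono)
      from ind[OF this y] show "h y * indicator {0..Suc k / n} y =
        h y * indicator {0..k / n} y + h y * indicator {k / n..Suc k / n} y"
        by (simp only: distrib_left)
    qed
    then have "(\<integral>\<^sup>+y. h y * indicator {0..Suc k / n} y \<partial>lborel) =
      (\<integral>\<^sup>+y. h y * indicator {0..k / n} y + h y * indicator {k / n..Suc k / n} y \<partial>lborel)"
      by (rule nn_integral_cong_AE)
    also have "\<dots> = (\<integral>\<^sup>+y. h y * indicator {0..k / n} y \<partial>lborel) +
        (\<integral>\<^sup>+y. h y * indicator {k / n..Suc k / n} y \<partial>lborel)"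
      by (rule nn_integral_add) auto
    finally show ?case using Suc by simp
  qed
  from this[of n] show ?thesis
    using n0 by (simp add: nn_integral_unif_affine[OF _ n] sum_distrib_left[symmetric] nn_integral_unif)
qed

text \<open>The count of smaller observations increases strictly with the value, hence is injective
  on a tie-free sample; its range lies below \<open>n\<close>, and comparing cardinalities gives
  surjectivity.\<close>

lemma bij_betw_rank:
  fixes x :: "nat \<Rightarrow> real"
  assumes "inj_on x {1..n}"
  shows "bij_betw (\<lambda>i. card {k\<in>{1..n}. x k < x i}) {1..n} {..<n}"
proof -
  let ?r = "\<lambda>i. card {k\<in>{1..n}. x k < x i}"
  have less: "?r i < ?r j" if "i \<in> {1..n}" "x i < x j" for i j
    using that by (intro psubset_card_mono) auto
  have inj: "inj_on ?r {1..n}"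
  proof (rule inj_onI)
    fix i j assume ij: "i \<in> {1..n}" "j \<in> {1..n}" "?r i = ?r j"
    then have "x i = x j"
      using less[of i j] less[of j i] by (cases "x i" "x j" rule: linorder_cases) auto
    then show "i = j" using assms ij by (auto dest: inj_onD)
  qed
  have "?r i < n" if "i \<in> {1..n}" for i
  proof -
    have "?r i < card {1..n}"
    proof (rule psubset_card_mono)
      have "i \<in> {1..n} - {k\<in>{1..n}. x k < x i}" using that by simp
      then show "{k\<in>{1..n}. x k < x i} \<subset> {1..n}" by blast
    qed simp
    then show ?thesis by simp
  qed
  then have "?r ` {1..n} \<subseteq> {..<n}" by auto
  moreover have "card (?r ` {1..n}) = card {..<n}"
    using card_image[OF inj] by simp
  ultimately have "?r ` {1..n} = {..<n}"
    by (intro card_subset_eq) auto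
  with inj show ?thesis by (simp add: bij_betw_def)
qed

text \<open>Uniformity with no randomness in \<open>x\<close>: the ranks of a fixed tie-free sample
  visit each of the \<open>n\<close> cells once. Exchangeability later turns this average over the
  position \<open>i\<close> into an expectation for the last position.\<close>

lemma sum_rank_p_unif:
  assumes h: "h \<in> borel_measurable borel" and n: "n \<ge> 1" and inj: "inj_on x {1..n}"
  shows "(\<Sum>i=1..n. \<integral>\<^sup>+v. h (rank_p n x i v) \<partial>unif) = ennreal n * (\<integral>\<^sup>+v. h v \<partial>unif)"
proof -
  let ?r = "\<lambda>i. card {k\<in>{1..n}. x k < x i}"
  have "rank_p n x i v = (real (?r i) + v) / real n" if i: "i \<in> {1..n}" for i v
  proof -
    have "{k\<in>{1..n}. x k = x i} = {i}" using inj i by (auto dest: inj_onD)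
    then show ?thesis
      by (simp add: rank_p_def of_bool_def sum.If_cases Int_def)
  qed
  then have "(\<Sum>i=1..n. \<integral>\<^sup>+v. h (rank_p n x i v) \<partial>unif) =
      (\<Sum>i=1..n. \<integral>\<^sup>+v. h ((real (?r i) + v) / real n) \<partial>unif)"
    by (intro sum.cong refl) simp
  also have "\<dots> = (\<Sum>m<n. \<integral>\<^sup>+v. h ((real m + v) / real n) \<partial>unif)"
    by (rule sum.reindex_bij_betw[OF bij_betw_rank[OF inj]])
  finally show ?thesis
    using sum_nn_integral_unif_affine[OF h n] by simp
qed

lemma rank_p_permute:
  assumes "\<tau> permutes {1..n}"
  shows "rank_p n (x \<circ> \<tau>) i v = rank_p n x (\<tau> i) v"
proof -
  have "(\<Sum>k=1..n. g (x (\<tau> k))) = (\<Sum>k=1..n. g (x k))" for g :: "real \<Rightarrow> real"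
    by (rule sum.permute[OF assms, of "\<lambda>k. g (x k)", unfolded o_def, symmetric])
  from this[of "\<lambda>z. of_bool (z < x (\<tau> i))"] this[of "\<lambda>z. of_bool (z = x (\<tau> i))"]
  show ?thesis by (simp only: rank_p_def o_apply)
qed

lemma rank_p_cong:
  "(\<And>k. k \<in> {1..n} \<Longrightarrow> x k = y k) \<Longrightarrow> x i = y i \<Longrightarrow> rank_p n x i v = rank_p n y i v"
  by (simp add: rank_p_def)

text \<open>Transpositions generate all permutations and are all that is applied below. Only
  extensional \<open>x\<close> are tested, since these are the points of a product space over
  \<open>{1..n}\<close>.\<close>

definition symmetric_fun :: "nat \<Rightarrow> ((nat \<Rightarrow> real) \<Rightarrow> 'c) \<Rightarrow> bool" where
  "symmetric_fun n s \<longleftrightarrow> (\<forall>x\<in>extensional {1..n}. \<forall>i\<in>{1..n}. \<forall>j\<in>{1..n}. s (x \<circ> Transposition.transpose i j) = s x)"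

lemma rank_p_measurable:
  assumes "{1..n} \<subseteq> I" "i \<in> I" "\<And>k. k \<in> I \<Longrightarrow> sets (N k) = sets borel"
  shows "(\<lambda>(x, v). rank_p n x i v) \<in> borel_measurable (PiM I N \<Otimes>\<^sub>M borel)"
proof -
  let ?R = "PiM I (\<lambda>_. borel :: real measure) \<Otimes>\<^sub>M (borel :: real measure)"
  have e: "sets (PiM I N) = sets (PiM I (\<lambda>_. borel))"
    by (intro sets_PiM_cong) (auto simp: assms)
  have mk: "(\<lambda>x. fst x k) \<in> borel_measurable ?R" if "k \<in> I" for k
    using measurable_compose[OF measurable_fst measurable_component_singleton[OF that, of "\<lambda>_. borel"]] .
  have "(\<lambda>z. rank_p n (fst z) i (snd z)) \<in> borel_measurable ?R"
    unfolding rank_p_def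
  proof (intro borel_measurable_times borel_measurable_add borel_measurable_const
      borel_measurable_sum measurable_snd)
    fix k assume "k \<in> {1..n}"
    then have km: "(\<lambda>x. fst x k) \<in> borel_measurable ?R"
        and im: "(\<lambda>x. fst x i) \<in> borel_measurable ?R"
      using assms(1,2) mk by auto
    have "(\<lambda>z. of_bool (g z < h z) :: real) \<in> borel_measurable R"
      "(\<lambda>z. of_bool (g z = h z) :: real) \<in> borel_measurable R"
      if [measurable]: "g \<in> borel_measurable R" "h \<in> borel_measurable R"
      for g h :: "'c \<Rightarrow> real" and R by measurable
    from this[OF km im]
    show "(\<lambda>z. of_bool (fst z k < fst z i) :: real) \<in> borel_measurable ?R"
      "(\<lambda>z. of_bool (fst z k = fst z i) :: real) \<in> borel_measurable ?R"
      by simp_all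
  qed
  then show ?thesis
    unfolding case_prod_beta' measurable_cong_sets[OF sets_pair_measure_cong[OF e refl] refl] .
qed

section \<open>Exchangeability and ranks of an iid sample without atoms\<close>

locale atomless_distribution = real_distribution P for P :: "real measure" +
  assumes atomless: "emeasure P {x} = 0"
begin

abbreviation PP :: "nat \<Rightarrow> (nat \<Rightarrow> real) measure" where
  "PP n \<equiv> PiM {1..n} (\<lambda>_. P)"

lemma prob_space_base: "prob_space P"
  by (rule prob_space_axioms)

sublocale product_prob_space "\<lambda>_::nat. P" UNIV
  by unfold_locales

lemma AE_PP_inj: "AE x in PP n. inj_on x {1..n}"
proof -
  have *: "AE x in PP n. x i \<noteq> x k" if ik: "i \<in> {1..n}" "k \<in> {1..n}" "i \<noteq> k" for i k
  proof -
    let ?J = "{1..n} - {i}"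
    have J: "insert i ?J = {1..n}" using ik by auto
    have [measurable]: "(\<lambda>x. x i) \<in> borel_measurable (PP n)" "(\<lambda>x. x k) \<in> borel_measurable (PP n)"
      using ik by measurable
    have m: "{x \<in> space (PP n). x i = x k} \<in> sets (PP n)" by measurable
    have "emeasure (PP n) {x \<in> space (PP n). x i = x k} =
        (\<integral>\<^sup>+x. indicator {x \<in> space (PP n). x i = x k} x \<partial>PP n)"
      using m by simp
    \<comment> \<open>Fubini in coordinate \<open>i\<close>: with the others fixed, a tie means that
      a fresh draw hits the single point \<open>x k\<close>, which carries no mass.\<close>
    also have "\<dots> = (\<integral>\<^sup>+x. \<integral>\<^sup>+y. indicator {x \<in> space (PP n). x i = x k} (x(i := y)) \<partial>P \<partial>PiM ?J (\<lambda>_. P))"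
      using product_nn_integral_insert[of ?J i "indicator {x \<in> space (PP n). x i = x k}"] m
      unfolding J by simp
    also have "\<dots> = (\<integral>\<^sup>+x. \<integral>\<^sup>+y. indicator {x k} y \<partial>P \<partial>PiM ?J (\<lambda>_. P))"
      using ik by (intro nn_integral_cong) (auto simp: indicator_def space_PiM PiE_def extensional_def)
    also have "\<dots> = 0" by (simp add: atomless)
    finally show ?thesis using m by (subst AE_iff_measurable[OF m]) auto
  qed
  have "AE x in PP n. \<forall>i\<in>{1..n}. \<forall>k\<in>{1..n}. i \<noteq> k \<longrightarrow> x i \<noteq> x k"
    unfolding AE_ball_countable[OF countable_finite[OF finite_atLeastAtMost]]
  proof (intro ballI)
    fix i k assume "i \<in> {1..n}" "k \<in> {1..n}"
    then show "AE x in PP n. i \<noteq> k \<longrightarrow> x i \<noteq> x k" using * by (cases "i = k") auto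
  qed
  then show ?thesis by eventually_elim (auto simp: inj_on_def)
qed

lemma nn_integral_PP_transpose:
  assumes s: "s \<in> borel_measurable (PP n)" and ij: "i \<in> {1..n}" "j \<in> {1..n}"
  shows "(\<integral>\<^sup>+x. s (x \<circ> Transposition.transpose i j) \<partial>PP n) = (\<integral>\<^sup>+x. s x \<partial>PP n)"
proof -
  have per: "Transposition.transpose i j permutes {1..n}" using ij by (rule permutes_swap_id)
  have "distr (PP n) (PP n) (\<lambda>x. \<lambda>k\<in>{1..n}. x (Transposition.transpose i j k)) = PP n"
  proof (rule distr_PiM_reindex)
    show "Transposition.transpose i j \<in> {1..n} \<rightarrow> {1..n}" using permutes_in_image[OF per] by blast
    show "inj_on (Transposition.transpose i j) {1..n}" by (rule permutes_inj_on[OF per])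
    show "prob_space P" for k :: nat by (rule prob_space_base)
  qed
  then have "(\<integral>\<^sup>+x. s x \<partial>PP n) = (\<integral>\<^sup>+x. s x \<partial>distr (PP n) (PP n) (\<lambda>x. \<lambda>k\<in>{1..n}. x (Transposition.transpose i j k)))"
    by simp
  also have "\<dots> = (\<integral>\<^sup>+x. s (\<lambda>k\<in>{1..n}. x (Transposition.transpose i j k)) \<partial>PP n)"
    using permutes_in_image[OF per] s
    by (intro nn_integral_distr measurable_restrict measurable_component_singleton)
      (blast, simp only: measurable_distr_eq1)
  also have "\<dots> = (\<integral>\<^sup>+x. s (x \<circ> Transposition.transpose i j) \<partial>PP n)"
  proof (rule nn_integral_cong)
    fix x assume "x \<in> space (PP n)"
    then have "(\<lambda>k\<in>{1..n}. x (Transposition.transpose i j k)) = x \<circ> Transposition.transpose i j"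
      using permutes_not_in[OF per] by (auto simp: space_PiM PiE_def extensional_def restrict_def fun_eq_iff)
    then show "s (\<lambda>k\<in>{1..n}. x (Transposition.transpose i j k)) = s (x \<circ> Transposition.transpose i j)" by simp
  qed
  finally show ?thesis by simp
qed

lemma rank_mean_measurable:
  assumes [measurable]: "h \<in> borel_measurable borel" and "j \<in> {1..m}" "m \<le> n"
  shows "(\<lambda>x. \<integral>\<^sup>+v. h (rank_p m x j v) \<partial>unif) \<in> borel_measurable (PP n)"
proof -
  interpret unif: prob_space unif by (rule prob_space_unif)
  have "(\<lambda>(x, v). rank_p m x j v) \<in> borel_measurable (PP n \<Otimes>\<^sub>M borel)"
    using assms by (intro rank_p_measurable) auto
  then have "(\<lambda>z. h (rank_p m (fst z) j (snd z))) \<in> borel_measurable (PP n \<Otimes>\<^sub>M unif)"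
    by (subst measurable_cong_sets[OF sets_pair_measure_cong[OF refl sets_unif] refl])
      (auto simp: case_prod_beta')
  then show ?thesis
    by (intro unif.borel_measurable_nn_integral) (simp add: case_prod_beta')
qed

text \<open>Swapping positions \<open>i\<close> and \<open>n\<close> changes neither the law of the
  sample nor \<open>s\<close>, so the last rank may be replaced by the rank at any \<open>i\<close>.
  Summing over \<open>i\<close> makes the rank factor constant on tie-free samples, and the finite
  nonzero factor \<open>n\<close> cancels.\<close>

lemma nn_integral_symmetric_rank:
  assumes h: "h \<in> borel_measurable borel" and s: "s \<in> borel_measurable (PP n)"
    and sym: "symmetric_fun n s" and n: "n \<ge> 1"
  shows "(\<integral>\<^sup>+x. s x * (\<integral>\<^sup>+v. h (rank_p n x n v) \<partial>unif) \<partial>PP n) =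
    (\<integral>\<^sup>+x. s x \<partial>PP n) * (\<integral>\<^sup>+v. h v \<partial>unif)"
proof -
  let ?g = "\<lambda>i x. \<integral>\<^sup>+v. h (rank_p n x i v) \<partial>unif"
  note [measurable] = s
  have g [measurable]: "?g i \<in> borel_measurable (PP n)" if "i \<in> {1..n}" for i
    using rank_mean_measurable[OF h that] by simp
  have eq: "(\<integral>\<^sup>+x. s x * ?g n x \<partial>PP n) = (\<integral>\<^sup>+x. s x * ?g i x \<partial>PP n)" if i: "i \<in> {1..n}" for i
  proof -
    have "(\<integral>\<^sup>+x. s x * ?g n x \<partial>PP n) = (\<integral>\<^sup>+x. s (x \<circ> Transposition.transpose i n) * ?g n (x \<circ> Transposition.transpose i n) \<partial>PP n)"
      using i n by (intro nn_integral_PP_transpose[symmetric] borel_measurable_times_ennreal s g) auto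
    also have "\<dots> = (\<integral>\<^sup>+x. s x * ?g i x \<partial>PP n)"
    proof (rule nn_integral_cong)
      fix x assume x: "x \<in> space (PP n)"
      have "Transposition.transpose i n permutes {1..n}" using i n by (intro permutes_swap_id) auto
      then have "?g n (x \<circ> Transposition.transpose i n) = ?g i x" by (simp add: rank_p_permute)
      moreover have "s (x \<circ> Transposition.transpose i n) = s x"
        using sym x i n by (auto simp: symmetric_fun_def space_PiM PiE_def)
      ultimately show "s (x \<circ> Transposition.transpose i n) * ?g n (x \<circ> Transposition.transpose i n) = s x * ?g i x" by simp
    qed
    finally show ?thesis .
  qed
  have "ennreal n * (\<integral>\<^sup>+x. s x * ?g n x \<partial>PP n) = (\<Sum>i=1..n. \<integral>\<^sup>+x. s x * ?g i x \<partial>PP n)"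
    using sum.cong[OF refl eq[symmetric], of "{1..n}"] by (simp add: ennreal_of_nat_eq_real_of_nat)
  also have "\<dots> = (\<integral>\<^sup>+x. (\<Sum>i=1..n. s x * ?g i x) \<partial>PP n)"
    by (intro nn_integral_sum[symmetric] borel_measurable_times_ennreal g s)
  also have "\<dots> = (\<integral>\<^sup>+x. s x * (ennreal n * (\<integral>\<^sup>+v. h v \<partial>unif)) \<partial>PP n)"
  proof (rule nn_integral_cong_AE, use AE_PP_inj[of n] in eventually_elim)
    fix x :: "nat \<Rightarrow> real" assume "inj_on x {1..n}"
    then show "(\<Sum>i=1..n. s x * ?g i x) = s x * (ennreal n * (\<integral>\<^sup>+v. h v \<partial>unif))"
      using sum_rank_p_unif[OF h n, of x] by (simp add: sum_distrib_left[symmetric])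
  qed
  also have "\<dots> = (\<integral>\<^sup>+x. s x \<partial>PP n) * (ennreal n * (\<integral>\<^sup>+v. h v \<partial>unif))"
    by (rule nn_integral_multc[OF s])
  finally have "ennreal n * (\<integral>\<^sup>+x. s x * ?g n x \<partial>PP n) =
      ennreal n * ((\<integral>\<^sup>+x. s x \<partial>PP n) * (\<integral>\<^sup>+v. h v \<partial>unif))"
    by (simp add: mult_ac)
  then show ?thesis using n by (simp add: ennreal_mult_cancel_left)
qed

text \<open>Carrying a symmetric factor \<open>s\<close> makes the induction work: once the last observation is
  fixed, its rank is a symmetric function of the earlier ones and is absorbed into \<open>s\<close>.\<close>

lemma nn_integral_symmetric_prod_ranks:
  assumes h: "\<And>j. h j \<in> borel_measurable borel"
    and s: "s \<in> borel_measurable (PP n)" and sym: "symmetric_fun n s"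
  shows "(\<integral>\<^sup>+x. s x * (\<Prod>j=1..n. \<integral>\<^sup>+v. h j (rank_p j x j v) \<partial>unif) \<partial>PP n) =
    (\<integral>\<^sup>+x. s x \<partial>PP n) * (\<Prod>j=1..n. \<integral>\<^sup>+v. h j v \<partial>unif)"
  using s sym
proof (induction n arbitrary: s)
  case 0
  then show ?case by simp
next
  case (Suc n)
  let ?g = "\<lambda>j x. \<integral>\<^sup>+v. h j (rank_p j x j v) \<partial>unif"
  let ?n = "Suc n"
  have ins: "insert ?n {1..n} = {1..?n}" by auto
  have g: "?g j \<in> borel_measurable (PP ?n)" if "j \<in> {1..?n}" for j
    using that by (intro rank_mean_measurable h) auto
  note [measurable] = \<open>s \<in> _\<close>
  have sg: "(\<lambda>x. s x * ?g ?n x) \<in> borel_measurable (PP ?n)"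
    by (intro borel_measurable_times_ennreal g Suc.prems) auto
  have upd: "(\<lambda>x. x(?n := y)) \<in> measurable (PP n) (PP ?n)" for y
    using measurable_compose[OF measurable_Pair2'[of y P "PP n"] measurable_add_dim[of ?n "{1..n}" "\<lambda>_. P"]]
    unfolding ins by simp
  have "(\<integral>\<^sup>+x. s x * (\<Prod>j=1..?n. ?g j x) \<partial>PP ?n) =
      (\<integral>\<^sup>+y. \<integral>\<^sup>+x. s (x(?n := y)) * (\<Prod>j=1..?n. ?g j (x(?n := y))) \<partial>PP n \<partial>P)"
    by (rule product_nn_integral_insert_rev[of "{1..n}" ?n "\<lambda>x. s x * (\<Prod>j=1..?n. ?g j x)", unfolded ins])
      (intro borel_measurable_times_ennreal borel_measurable_prod_ennreal g Suc.prems | simp)+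
  \<comment> \<open>The ranks at times up to \<open>n\<close> do not involve the observation
    \<open>y\<close> at time \<open>Suc n\<close>; among the rank factors only the last one
    does.\<close>
  also have "\<dots> = (\<integral>\<^sup>+y. \<integral>\<^sup>+x. (s (x(?n := y)) * ?g ?n (x(?n := y))) * (\<Prod>j=1..n. ?g j x) \<partial>PP n \<partial>P)"
  proof (intro nn_integral_cong)
    fix x y
    have "?g j (x(?n := y)) = ?g j x" if "j \<in> {1..n}" for j
      using that by (intro nn_integral_cong arg_cong[of _ _ "h j"] rank_p_cong) auto
    then show "s (x(?n := y)) * (\<Prod>j=1..?n. ?g j (x(?n := y))) =
       (s (x(?n := y)) * ?g ?n (x(?n := y))) * (\<Prod>j=1..n. ?g j x)"
      by (simp add: mult_ac)
  qed
  also have "\<dots> = (\<integral>\<^sup>+y. (\<integral>\<^sup>+x. s (x(?n := y)) * ?g ?n (x(?n := y)) \<partial>PP n) *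
      (\<Prod>j=1..n. \<integral>\<^sup>+v. h j v \<partial>unif) \<partial>P)"
  proof (intro nn_integral_cong Suc.IH)
    fix y
    show "(\<lambda>x. s (x(?n := y)) * ?g ?n (x(?n := y))) \<in> borel_measurable (PP n)"
      using measurable_compose[OF upd sg] by simp
    \<comment> \<open>A transposition of the first \<open>n\<close> positions fixes
      \<open>Suc n\<close>, so it acts on the sample extended by \<open>y\<close> as a transposition
      of \<open>{1..Suc n}\<close>, and the rank of \<open>y\<close> does not change.\<close>
    show "symmetric_fun n (\<lambda>x. s (x(?n := y)) * ?g ?n (x(?n := y)))"
      unfolding symmetric_fun_def
    proof (intro ballI)
      fix x :: "nat \<Rightarrow> real" and i j assume x: "x \<in> extensional {1..n}" and ij: "i \<in> {1..n}" "j \<in> {1..n}"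
      have per: "Transposition.transpose i j permutes {1..?n}" using ij by (intro permutes_swap_id) auto
      have e: "(x \<circ> Transposition.transpose i j)(?n := y) = x(?n := y) \<circ> Transposition.transpose i j"
        using ij by (auto simp: fun_eq_iff Transposition.transpose_def)
      have "x(?n := y) \<in> extensional {1..?n}" using x by (auto simp: extensional_def)
      then have "s (x(?n := y) \<circ> Transposition.transpose i j) = s (x(?n := y))"
        using Suc.prems(2) ij unfolding symmetric_fun_def by auto
      moreover have "Transposition.transpose i j ?n = ?n" using ij by (auto simp: Transposition.transpose_def)
      ultimately show "s ((x \<circ> Transposition.transpose i j)(?n := y)) * ?g ?n ((x \<circ> Transposition.transpose i j)(?n := y)) =
          s (x(?n := y)) * ?g ?n (x(?n := y))"
        unfolding e by (simp add: rank_p_permute[OF per])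
    qed
  qed
  also have "\<dots> = (\<integral>\<^sup>+y. (\<integral>\<^sup>+x. s (x(?n := y)) * ?g ?n (x(?n := y)) \<partial>PP n) \<partial>P) *
      (\<Prod>j=1..n. \<integral>\<^sup>+v. h j v \<partial>unif)"
  proof (rule nn_integral_multc)
    interpret F: finite_product_prob_space "\<lambda>_. P" "{1..n}" by unfold_locales auto
    have "(\<lambda>(x, y). x(?n := y)) \<in> measurable (PP n \<Otimes>\<^sub>M P) (PP ?n)"
      using measurable_add_dim[of ?n "{1..n}" "\<lambda>_. P"] unfolding ins .
    from measurable_compose[OF this sg] have "(\<lambda>(y, x). s (x(?n := y)) * ?g ?n (x(?n := y))) \<in> borel_measurable (P \<Otimes>\<^sub>M PP n)"
      by (subst measurable_pair_swap_iff) (simp add: case_prod_beta')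
    then show "(\<lambda>y. \<integral>\<^sup>+x. s (x(?n := y)) * ?g ?n (x(?n := y)) \<partial>PP n) \<in> borel_measurable P"
      by (rule F.borel_measurable_nn_integral)
  qed
  \<comment> \<open>Undoing the split over the last coordinate leaves a single rank against the
    original \<open>s\<close>, which is the case already settled.\<close>
  also have "(\<integral>\<^sup>+y. (\<integral>\<^sup>+x. s (x(?n := y)) * ?g ?n (x(?n := y)) \<partial>PP n) \<partial>P) =
     (\<integral>\<^sup>+x. s x * ?g ?n x \<partial>PP ?n)"
    using product_nn_integral_insert_rev[of "{1..n}" ?n "\<lambda>x. s x * ?g ?n x"] sg
    unfolding ins by simp
  also have "\<dots> = (\<integral>\<^sup>+x. s x \<partial>PP ?n) * (\<integral>\<^sup>+v. h ?n v \<partial>unif)"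
    by (rule nn_integral_symmetric_rank) (use Suc.prems h in auto)
  finally show ?case by (simp add: mult_ac)
qed

end

section \<open>Mixture wealth: locality and measurability\<close>

lemma mixture_M_cong:
  "(\<And>j. j \<in> {k..t} \<Longrightarrow> p j = q j) \<Longrightarrow> mixture_M \<mu> d p k t = mixture_M \<mu> d q k t"
  unfolding mixture_M_def by (intro nn_integral_cong prod.cong) auto

lemma stat_S_cong:
  "(\<And>j. j \<in> {1..t} \<Longrightarrow> p j = q j) \<Longrightarrow> stat_S \<mu> d w p t = stat_S \<mu> d w q t"
  unfolding stat_S_def by (intro sum.cong refl arg_cong2[of _ _ _ _ "(*)"] mixture_M_cong) auto

lemma nn_integral_density_on_unit:
  assumes "density_on_unit g"
  shows "(\<integral>\<^sup>+v. ennreal (g v) \<partial>unif) = 1"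
  using assms by (subst nn_integral_unif) (auto simp: density_on_unit_def)

locale density_mixture =
  fixes \<mu> :: "'b measure" and d :: "'b \<Rightarrow> real \<Rightarrow> real"
  assumes family: "density_family \<mu> d"
begin

sublocale \<mu>: prob_space \<mu>
  using family by (simp add: density_family_def)

lemma density_joint_measurable:
  assumes [measurable]: "f \<in> borel_measurable N"
  shows "(\<lambda>z. ennreal (d (snd z) (f (fst z)))) \<in> borel_measurable (N \<Otimes>\<^sub>M \<mu>)"
proof -
  have d: "(\<lambda>(\<theta>, u). d \<theta> u) \<in> borel_measurable (\<mu> \<Otimes>\<^sub>M borel)"
    using family by (simp add: density_family_def)
  have "(\<lambda>z. (snd z, f (fst z))) \<in> measurable (N \<Otimes>\<^sub>M \<mu>) (\<mu> \<Otimes>\<^sub>M borel)" by measurable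
  from measurable_compose[OF this d] show ?thesis by simp
qed

lemma prod_density_measurable:
  assumes "\<And>j. j \<in> J \<Longrightarrow> p j \<in> borel_measurable N"
  shows "(\<lambda>z. \<Prod>j\<in>J. ennreal (d (snd z) (p j (fst z)))) \<in> borel_measurable (N \<Otimes>\<^sub>M \<mu>)"
  using assms by (intro borel_measurable_prod_ennreal density_joint_measurable)

lemma mixture_M_measurable:
  assumes "\<And>j. j \<in> {k..t} \<Longrightarrow> p j \<in> borel_measurable N"
  shows "(\<lambda>\<omega>. mixture_M \<mu> d (\<lambda>j. p j \<omega>) k t) \<in> borel_measurable N"
  unfolding mixture_M_def
  using prod_density_measurable[of "{k..t}" p N] assms
  by (intro \<mu>.borel_measurable_nn_integral) (simp add: case_prod_beta')

lemma stat_S_measurable: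
  assumes "\<And>j. j \<ge> 1 \<Longrightarrow> j \<le> t \<Longrightarrow> p j \<in> borel_measurable N"
  shows "(\<lambda>\<omega>. stat_S \<mu> d w (\<lambda>j. p j \<omega>) t) \<in> borel_measurable N"
  unfolding stat_S_def
  by (intro borel_measurable_sum borel_measurable_times_ennreal borel_measurable_const mixture_M_measurable)
    (use assms in auto)

text \<open>The empty product: a bet opened at time \<open>t + 1\<close> starts from capital 1. This
  is the origin of the increment \<open>w (t + 1)\<close> in \<open>cum_weight\<close>.\<close>

lemma mixture_M_Suc_self [simp]: "mixture_M \<mu> d p (Suc t) t = 1"
  by (simp add: mixture_M_def \<mu>.emeasure_space_1)

end

section \<open>Joint law of the pre-change p-values of one row\<close>

locale changepoint = P0: atomless_distribution P0 + P1: real_distribution P1 + prob_space M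
  for P0 P1 :: "real measure" and M :: "'a measure" +
  fixes T :: nat and X U :: "nat \<Rightarrow> 'a \<Rightarrow> real"
  assumes row: "changepoint_row M P0 T P1 X U"
begin

abbreviation p :: "nat \<Rightarrow> 'a \<Rightarrow> real" where
  "p j \<omega> \<equiv> conformal_p (\<lambda>j. X j \<omega>) (\<lambda>j. U j \<omega>) j"

lemma indep: "indep_vars (\<lambda>_. borel) (case_sum X U) ({1..} <+> {1..})"
  using row by (simp add: changepoint_row_def)

lemma
  assumes "j \<ge> 1"
  shows X_measurable: "X j \<in> borel_measurable M" and U_measurable: "U j \<in> borel_measurable M"
proof -
  have "case_sum X U i \<in> borel_measurable M" if "i \<in> {1..} <+> {1..}" for i
    using indep that by (auto simp: indep_vars_def)
  from this[of "Inl j"] this[of "Inr j"] assms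
  show "X j \<in> borel_measurable M" "U j \<in> borel_measurable M" by auto
qed

lemma
  assumes "j \<ge> 1"
  shows distr_X: "distr M borel (X j) = (if j \<le> T then P0 else P1)" and distr_U: "distr M borel (U j) = unif"
  using row assms by (simp_all add: changepoint_row_def)

lemma p_measurable: "p j \<in> borel_measurable M"
proof (cases "j = 0")
  case True
  then show ?thesis by (simp add: conformal_p_def)
next
  case False
  have [measurable]: "X j \<in> borel_measurable M" "U j \<in> borel_measurable M"
    using False by (auto intro: X_measurable U_measurable)
  have [measurable]: "(\<lambda>\<omega>. of_bool (X i \<omega> < X j \<omega>) :: real) \<in> borel_measurable M"
    "(\<lambda>\<omega>. of_bool (X i \<omega> = X j \<omega>) :: real) \<in> borel_measurable M" if "i \<in> {1..j}" for i
  proof -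
    have [measurable]: "X i \<in> borel_measurable M" using that by (auto intro: X_measurable)
    show "(\<lambda>\<omega>. of_bool (X i \<omega> < X j \<omega>) :: real) \<in> borel_measurable M"
      "(\<lambda>\<omega>. of_bool (X i \<omega> = X j \<omega>) :: real) \<in> borel_measurable M" by measurable
  qed
  show ?thesis unfolding conformal_p_def by measurable
qed

lemma indep_vars_X: "I \<subseteq> {1..} \<Longrightarrow> indep_vars (\<lambda>_. borel) X I"
  and indep_vars_U: "I \<subseteq> {1..} \<Longrightarrow> indep_vars (\<lambda>_. borel) U I"
proof -
  assume I: "I \<subseteq> {1..}"
  have "indep_vars (\<lambda>j. PiM {Inl j} (\<lambda>_. borel)) (\<lambda>j \<omega>. restrict (\<lambda>i. case_sum X U i \<omega>) {Inl j}) I"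
    using I by (intro indep_vars_restrict[OF indep]) (auto simp: disjoint_family_on_def)
  from indep_vars_compose2[OF this, of "\<lambda>j z. z (Inl j)" "\<lambda>_. borel"]
  show "indep_vars (\<lambda>_. borel) X I" by simp
  have "indep_vars (\<lambda>j. PiM {Inr j} (\<lambda>_. borel)) (\<lambda>j \<omega>. restrict (\<lambda>i. case_sum X U i \<omega>) {Inr j}) I"
    using I by (intro indep_vars_restrict[OF indep]) (auto simp: disjoint_family_on_def)
  from indep_vars_compose2[OF this, of "\<lambda>j z. z (Inr j)" "\<lambda>_. borel"]
  show "indep_vars (\<lambda>_. borel) U I" by simp
qed

lemma indep_var_XU:
  assumes "I \<subseteq> {1..}" "J \<subseteq> {1..}"
  shows "indep_var (PiM I (\<lambda>_. borel)) (\<lambda>\<omega>. \<lambda>i\<in>I. X i \<omega>) (PiM J (\<lambda>_. borel)) (\<lambda>\<omega>. \<lambda>j\<in>J. U j \<omega>)"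
proof -
  have "indep_var (PiM (Inl ` I) (\<lambda>_. borel)) (\<lambda>\<omega>. restrict (\<lambda>i. case_sum X U i \<omega>) (Inl ` I))
      (PiM (Inr ` J) (\<lambda>_. borel)) (\<lambda>\<omega>. restrict (\<lambda>i. case_sum X U i \<omega>) (Inr ` J))"
    using assms by (intro indep_var_restrict[OF indep]) auto
  moreover have "(\<lambda>z. \<lambda>i\<in>I. z (Inl i)) \<in> measurable (PiM (Inl ` I) (\<lambda>_. borel)) (PiM I (\<lambda>_. borel))"
    by (intro measurable_restrict measurable_component_singleton) auto
  moreover have "(\<lambda>z. \<lambda>i\<in>J. z (Inr i)) \<in> measurable (PiM (Inr ` J) (\<lambda>_. borel)) (PiM J (\<lambda>_. borel))"
    by (intro measurable_restrict measurable_component_singleton) auto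
  ultimately have "indep_var (PiM I (\<lambda>_. borel))
      ((\<lambda>z. \<lambda>i\<in>I. z (Inl i)) \<circ> (\<lambda>\<omega>. restrict (\<lambda>i. case_sum X U i \<omega>) (Inl ` I)))
      (PiM J (\<lambda>_. borel)) ((\<lambda>z. \<lambda>i\<in>J. z (Inr i)) \<circ> (\<lambda>\<omega>. restrict (\<lambda>i. case_sum X U i \<omega>) (Inr ` J)))"
    by (rule indep_var_compose)
  then show ?thesis by (simp add: o_def restrict_def cong: if_cong)
qed

lemma distr_XU:
  assumes n: "1 \<le> n" "n \<le> T"
  shows "distr M (PiM {1..n} (\<lambda>_. borel) \<Otimes>\<^sub>M PiM {1..n} (\<lambda>_. borel))
      (\<lambda>\<omega>. (\<lambda>i\<in>{1..n}. X i \<omega>, \<lambda>i\<in>{1..n}. U i \<omega>)) =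
    PiM {1..n} (\<lambda>_. P0) \<Otimes>\<^sub>M PiM {1..n} (\<lambda>_. unif)"
proof -
  have "distr M (PiM {1..n} (\<lambda>_. borel)) (\<lambda>\<omega>. \<lambda>i\<in>{1..n}. X i \<omega>) = PiM {1..n} (\<lambda>i. distr M borel (X i))"
    using n(1) by (intro indep_vars_iff_distr_eq_PiM'[THEN iffD1] indep_vars_X) (auto intro: X_measurable)
  also have "\<dots> = PiM {1..n} (\<lambda>_. P0)"
    using n by (intro PiM_cong) (auto simp: distr_X)
  finally have 1: "distr M (PiM {1..n} (\<lambda>_. borel)) (\<lambda>\<omega>. \<lambda>i\<in>{1..n}. X i \<omega>) = PiM {1..n} (\<lambda>_. P0)" .
  have "distr M (PiM {1..n} (\<lambda>_. borel)) (\<lambda>\<omega>. \<lambda>i\<in>{1..n}. U i \<omega>) = PiM {1..n} (\<lambda>i. distr M borel (U i))"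
    using n(1) by (intro indep_vars_iff_distr_eq_PiM'[THEN iffD1] indep_vars_U) (auto intro: U_measurable)
  also have "\<dots> = PiM {1..n} (\<lambda>_. unif)"
    using n by (intro PiM_cong) (auto simp: distr_U)
  finally have 2: "distr M (PiM {1..n} (\<lambda>_. borel)) (\<lambda>\<omega>. \<lambda>i\<in>{1..n}. U i \<omega>) = PiM {1..n} (\<lambda>_. unif)" .
  have "indep_var (PiM {1..n} (\<lambda>_. borel)) (\<lambda>\<omega>. \<lambda>i\<in>{1..n}. X i \<omega>)
      (PiM {1..n} (\<lambda>_. borel)) (\<lambda>\<omega>. \<lambda>j\<in>{1..n}. U j \<omega>)"
    by (rule indep_var_XU) auto
  then show ?thesis
    unfolding indep_var_distribution_eq 1 2 by metis
qed

text \<open>Given the observations, the randomizers are independent and each enters one p-value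
  only, so integrating them out first splits the product into one-dimensional factors. The result on
  ranks then applies with the constant symmetric factor 1.\<close>

lemma nn_integral_prod_p:
  assumes n: "1 \<le> n" "n \<le> T" and h: "\<And>j. h j \<in> borel_measurable borel"
  shows "(\<integral>\<^sup>+\<omega>. (\<Prod>j=1..n. h j (p j \<omega>)) \<partial>M) = (\<Prod>j=1..n. \<integral>\<^sup>+v. h j v \<partial>unif)"
proof -
  interpret unif: product_prob_space "\<lambda>_::nat. unif" UNIV
    by (intro product_prob_spaceI prob_space_unif)
  interpret V: prob_space "PiM {1..n} (\<lambda>_. unif)"
    by (intro prob_space_PiM prob_space_unif)
  let ?B = "PiM {1..n} (\<lambda>_. borel) \<Otimes>\<^sub>M PiM {1..n} (\<lambda>_. borel) :: ((nat \<Rightarrow> real) \<times> (nat \<Rightarrow> real)) measure"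
  let ?Q = "PiM {1..n} (\<lambda>_. P0)" and ?V = "PiM {1..n} (\<lambda>_. unif)"
  let ?\<Phi> = "\<lambda>z. \<Prod>j=1..n. h j (rank_p j (fst z) j (snd z j))"
  have sB: "sets (?Q \<Otimes>\<^sub>M ?V) = sets ?B"
    by (intro sets_pair_measure_cong sets_PiM_cong) auto
  have \<Phi>: "?\<Phi> \<in> borel_measurable ?B"
  proof (intro borel_measurable_prod_ennreal measurable_compose[OF _ h])
    fix j assume j: "j \<in> {1..n}"
    have "(\<lambda>z. (fst z, snd z j)) \<in> measurable ?B (PiM {1..n} (\<lambda>_. borel) \<Otimes>\<^sub>M borel)"
      using j by (intro measurable_Pair measurable_fst measurable_compose[OF measurable_snd]
          measurable_component_singleton)
    moreover have "(\<lambda>(x, v). rank_p j x j v) \<in> borel_measurable (PiM {1..n} (\<lambda>_. borel) \<Otimes>\<^sub>M borel)"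
      using j by (intro rank_p_measurable) auto
    ultimately show "(\<lambda>z. rank_p j (fst z) j (snd z j)) \<in> borel_measurable ?B"
      using measurable_compose[where g = "\<lambda>(x, v). rank_p j x j v"] by fastforce
  qed
  have XU: "(\<lambda>\<omega>. (\<lambda>i\<in>{1..n}. X i \<omega>, \<lambda>i\<in>{1..n}. U i \<omega>)) \<in> measurable M ?B"
    by (intro measurable_Pair measurable_restrict X_measurable U_measurable) auto
  have "(\<integral>\<^sup>+\<omega>. (\<Prod>j=1..n. h j (p j \<omega>)) \<partial>M) =
      (\<integral>\<^sup>+\<omega>. ?\<Phi> (\<lambda>i\<in>{1..n}. X i \<omega>, \<lambda>i\<in>{1..n}. U i \<omega>) \<partial>M)"
    unfolding conformal_p_eq_rank_p
    by (intro nn_integral_cong prod.cong refl arg_cong[of _ _ "h _"]) (auto simp: rank_p_def)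
  also have "\<dots> = (\<integral>\<^sup>+z. ?\<Phi> z \<partial>(?Q \<Otimes>\<^sub>M ?V))"
    unfolding distr_XU[OF n, symmetric] using \<Phi> by (intro nn_integral_distr[symmetric, OF XU]) simp
  also have "\<dots> = (\<integral>\<^sup>+x. \<integral>\<^sup>+u. ?\<Phi> (x, u) \<partial>?V \<partial>?Q)"
    by (rule V.nn_integral_fst[symmetric]) (use \<Phi> in \<open>simp add: measurable_cong_sets[OF sB refl]\<close>)
  also have "\<dots> = (\<integral>\<^sup>+x. (\<Prod>j=1..n. \<integral>\<^sup>+v. h j (rank_p j x j v) \<partial>unif) \<partial>?Q)"
  proof (intro nn_integral_cong)
    fix x
    have "(\<lambda>v. h j (rank_p j x j v)) \<in> borel_measurable unif" for j
      unfolding rank_p_def using h[of j] by measurable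
    from unif.product_nn_integral_prod[of "{1..n}" "\<lambda>j v. h j (rank_p j x j v)", OF _ this]
    show "(\<integral>\<^sup>+u. ?\<Phi> (x, u) \<partial>?V) = (\<Prod>j=1..n. \<integral>\<^sup>+v. h j (rank_p j x j v) \<partial>unif)" by simp
  qed
  also have "\<dots> = (\<Prod>j=1..n. \<integral>\<^sup>+v. h j v \<partial>unif)"
  proof -
    interpret Q: prob_space ?Q by (intro prob_space_PiM P0.prob_space_base)
    have "symmetric_fun n (\<lambda>_. 1 :: ennreal)" by (simp add: symmetric_fun_def)
    from P0.nn_integral_symmetric_prod_ranks[of h "\<lambda>_. 1" n, OF h _ this] show ?thesis
      by (simp add: Q.emeasure_space_1 del: One_nat_def)
  qed
  finally show ?thesis .
qed

lemma distr_p: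
  assumes n: "1 \<le> n" "n \<le> T"
  shows "distr M (PiM {1..n} (\<lambda>_. borel)) (\<lambda>\<omega>. \<lambda>j\<in>{1..n}. p j \<omega>) = PiM {1..n} (\<lambda>_. unif)"
proof -
  interpret unif: product_prob_space "\<lambda>_::nat. unif" UNIV
    by (intro product_prob_spaceI prob_space_unif)
  have pm: "(\<lambda>\<omega>. \<lambda>j\<in>{1..n}. p j \<omega>) \<in> measurable M (PiM {1..n} (\<lambda>_. borel))"
    by (intro measurable_restrict p_measurable)
  show ?thesis
  proof (rule unif.PiM_eqI)
    show "sets (distr M (PiM {1..n} (\<lambda>_. borel)) (\<lambda>\<omega>. \<lambda>j\<in>{1..n}. p j \<omega>)) = sets (PiM {1..n} (\<lambda>_. unif))"
      by (simp cong: sets_PiM_cong)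
    fix A :: "nat \<Rightarrow> real set" assume A: "\<And>i. i \<in> {1..n} \<Longrightarrow> A i \<in> sets unif"
    \<comment> \<open>Extending \<open>A\<close> by the empty set makes every \<open>B i\<close>
      Borel, because the product formula asks for measurable functions at all indices, also outside
      \<open>{1..n}\<close>.\<close>
    define B where "B i = (if i \<in> {1..n} then A i else {})" for i
    have B: "B i \<in> sets borel" for i using A[of i] by (simp add: B_def)
    have AB: "PiE {1..n} A = PiE {1..n} B" by (intro PiE_cong) (simp add: B_def)
    have "emeasure (distr M (PiM {1..n} (\<lambda>_. borel)) (\<lambda>\<omega>. \<lambda>j\<in>{1..n}. p j \<omega>)) (PiE {1..n} A) =
        (\<integral>\<^sup>+\<omega>. indicator (PiE {1..n} B) (\<lambda>j\<in>{1..n}. p j \<omega>) \<partial>M)"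
      unfolding AB using B by (subst nn_integral_indicator[symmetric], simp)
        (subst nn_integral_distr[OF pm], auto)
    also have "\<dots> = (\<integral>\<^sup>+\<omega>. (\<Prod>j=1..n. indicator (B j) (p j \<omega>)) \<partial>M)"
      by (intro nn_integral_cong) (auto simp: indicator_def PiE_iff prod_zero_iff)
    also have "\<dots> = (\<Prod>j=1..n. \<integral>\<^sup>+v. indicator (B j) v \<partial>unif)"
      using B by (intro nn_integral_prod_p n) auto
    also have "\<dots> = (\<Prod>j=1..n. emeasure unif (A j))"
      using A by (intro prod.cong refl) (simp add: B_def)
    finally show "emeasure (distr M (PiM {1..n} (\<lambda>_. borel)) (\<lambda>\<omega>. \<lambda>j\<in>{1..n}. p j \<omega>)) (PiE {1..n} A) =
        (\<Prod>j=1..n. emeasure unif (A j))" .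
  qed auto
qed

text \<open>Testing against an arbitrary function \<open>G\<close> of the past replaces conditional
  expectations. Later \<open>G\<close> carries both the wealth so far and the indicator of not
  having stopped.\<close>

lemma nn_integral_p_Suc:
  assumes t: "Suc t \<le> T" and G: "G \<in> borel_measurable (PiM {1..t} (\<lambda>_. borel))"
    and h [measurable]: "h \<in> borel_measurable borel"
  shows "(\<integral>\<^sup>+\<omega>. G (\<lambda>j\<in>{1..t}. p j \<omega>) * h (p (Suc t) \<omega>) \<partial>M) =
    (\<integral>\<^sup>+\<omega>. G (\<lambda>j\<in>{1..t}. p j \<omega>) \<partial>M) * (\<integral>\<^sup>+v. h v \<partial>unif)"
proof -
  interpret unif: product_prob_space "\<lambda>_::nat. unif" UNIV
    by (intro product_prob_spaceI prob_space_unif)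
  let ?n = "Suc t" and ?Un = "PiM {1..Suc t} (\<lambda>_. unif)"
  let ?B = "PiM {1..?n} (\<lambda>_. borel) :: (nat \<Rightarrow> real) measure"
  have ins: "insert ?n {1..t} = {1..?n}" by auto
  have sU: "sets ?Un = sets ?B" by (intro sets_PiM_cong) auto
  have sUt: "sets (PiM {1..t} (\<lambda>_. unif)) = sets (PiM {1..t} (\<lambda>_. borel :: real measure))"
    by (intro sets_PiM_cong) auto
  have pm: "(\<lambda>\<omega>. \<lambda>j\<in>{1..?n}. p j \<omega>) \<in> measurable M ?B"
    by (intro measurable_restrict p_measurable)
  have Gr: "(\<lambda>y. G (restrict y {1..t})) \<in> borel_measurable ?B"
    by (rule measurable_compose[OF _ G])
      (intro measurable_restrict_subset, auto)
  \<comment> \<open>Proved for a general \<open>g\<close> because it is used twice: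
    \<open>g = h\<close> gives the left-hand side, and \<open>g = 1\<close> evaluates the integral
    of \<open>G\<close> on the right.\<close>
  have eval: "(\<integral>\<^sup>+\<omega>. G (\<lambda>j\<in>{1..t}. p j \<omega>) * g (p ?n \<omega>) \<partial>M) =
      (\<integral>\<^sup>+x. G x \<partial>PiM {1..t} (\<lambda>_. unif)) * (\<integral>\<^sup>+v. g v \<partial>unif)"
    if g: "g \<in> borel_measurable borel" for g :: "real \<Rightarrow> ennreal"
  proof -
    have Gg: "(\<lambda>y. G (restrict y {1..t}) * g (y ?n)) \<in> borel_measurable ?B"
      by (intro borel_measurable_times_ennreal Gr measurable_compose[OF _ g] measurable_component_singleton) auto
    have r: "restrict (\<lambda>j\<in>{1..?n}. p j \<omega>) {1..t} = (\<lambda>j\<in>{1..t}. p j \<omega>)" for \<omega>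
      by (auto simp: restrict_def)
    have "(\<integral>\<^sup>+\<omega>. G (\<lambda>j\<in>{1..t}. p j \<omega>) * g (p ?n \<omega>) \<partial>M) =
        (\<integral>\<^sup>+y. G (restrict y {1..t}) * g (y ?n) \<partial>distr M ?B (\<lambda>\<omega>. \<lambda>j\<in>{1..?n}. p j \<omega>))"
      by (subst nn_integral_distr[OF pm]) (use Gg r in simp_all)
    also have "\<dots> = (\<integral>\<^sup>+y. G (restrict y {1..t}) * g (y ?n) \<partial>PiM (insert ?n {1..t}) (\<lambda>_. unif))"
      by (subst distr_p[OF _ t]) (simp_all add: ins del: One_nat_def)
    also have "\<dots> = (\<integral>\<^sup>+x. \<integral>\<^sup>+v. G (restrict (x(?n := v)) {1..t}) * g ((x(?n := v)) ?n) \<partial>unif \<partial>PiM {1..t} (\<lambda>_. unif))"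
      by (rule unif.product_nn_integral_insert)
        (use Gg in \<open>simp_all add: ins measurable_cong_sets[OF sU refl] del: One_nat_def\<close>)
    also have "\<dots> = (\<integral>\<^sup>+x. \<integral>\<^sup>+v. G x * g v \<partial>unif \<partial>PiM {1..t} (\<lambda>_. unif))"
    proof (intro nn_integral_cong)
      fix x v assume "x \<in> space (PiM {1..t} (\<lambda>_. unif))"
      then have "restrict (x(?n := v)) {1..t} = x"
        by (auto simp: space_PiM PiE_def extensional_def fun_eq_iff)
      then show "G (restrict (x(?n := v)) {1..t}) * g ((x(?n := v)) ?n) = G x * g v" by simp
    qed
    also have "\<dots> = (\<integral>\<^sup>+x. G x * (\<integral>\<^sup>+v. g v \<partial>unif) \<partial>PiM {1..t} (\<lambda>_. unif))"
      using g by (intro nn_integral_cong nn_integral_cmult) simp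
    also have "\<dots> = (\<integral>\<^sup>+x. G x \<partial>PiM {1..t} (\<lambda>_. unif)) * (\<integral>\<^sup>+v. g v \<partial>unif)"
      using G by (intro nn_integral_multc) (simp add: measurable_cong_sets[OF sUt refl])
    finally show ?thesis .
  qed
  from eval[of "\<lambda>_. 1"] eval[OF h] show ?thesis by (simp add: prob_space.emeasure_space_1[OF prob_space_unif])
qed

end

subsection \<open>Ville's inequality\<close>

locale changepoint_mixture = changepoint P0 P1 M T X U + density_mixture \<mu> d
  for P0 P1 :: "real measure" and M :: "'a measure" and T X U and \<mu> :: "'b measure" and d +
  fixes w :: "nat \<Rightarrow> real" and b :: real
  assumes w_nonneg: "\<And>k. k \<ge> 1 \<Longrightarrow> w k \<ge> 0" and b_pos: "b > 0"
begin

text \<open>The martingale property of each wealth process. For a fixed parameter the newest density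
  factor integrates to 1 under the uniform law, and Tonelli carries this through the mixture. For
  \<open>k = Suc t\<close> the right-hand side contains the empty product, the starting capital of a
  fresh bet.\<close>

lemma nn_integral_mixture_Suc:
  assumes t: "Suc t \<le> T" and G: "G \<in> borel_measurable (PiM {1..t} (\<lambda>_. borel))"
    and k: "1 \<le> k" "k \<le> Suc t"
  shows "(\<integral>\<^sup>+\<omega>. G (\<lambda>j\<in>{1..t}. p j \<omega>) * mixture_M \<mu> d (\<lambda>j. p j \<omega>) k (Suc t) \<partial>M) =
    (\<integral>\<^sup>+\<omega>. G (\<lambda>j\<in>{1..t}. p j \<omega>) * mixture_M \<mu> d (\<lambda>j. p j \<omega>) k t \<partial>M)"
proof -
  interpret MM: pair_sigma_finite M \<mu> by unfold_locales
  have Gp: "(\<lambda>\<omega>. G (\<lambda>j\<in>{1..t}. p j \<omega>)) \<in> borel_measurable M"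
    by (intro measurable_compose[OF _ G] measurable_restrict p_measurable)
  have swap: "(\<integral>\<^sup>+\<omega>. G (\<lambda>j\<in>{1..t}. p j \<omega>) * mixture_M \<mu> d (\<lambda>j. p j \<omega>) k s \<partial>M) =
      (\<integral>\<^sup>+\<theta>. \<integral>\<^sup>+\<omega>. G (\<lambda>j\<in>{1..t}. p j \<omega>) * (\<Prod>j=k..s. ennreal (d \<theta> (p j \<omega>))) \<partial>M \<partial>\<mu>)" for s
  proof -
    have pr: "(\<lambda>z. \<Prod>j=k..s. ennreal (d (snd z) (p j (fst z)))) \<in> borel_measurable (M \<Otimes>\<^sub>M \<mu>)"
      by (intro prod_density_measurable p_measurable)
    have "(\<integral>\<^sup>+\<omega>. G (\<lambda>j\<in>{1..t}. p j \<omega>) * mixture_M \<mu> d (\<lambda>j. p j \<omega>) k s \<partial>M) =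
      (\<integral>\<^sup>+\<omega>. \<integral>\<^sup>+\<theta>. G (\<lambda>j\<in>{1..t}. p j \<omega>) * (\<Prod>j=k..s. ennreal (d \<theta> (p j \<omega>))) \<partial>\<mu> \<partial>M)"
      unfolding mixture_M_def
      by (intro nn_integral_cong nn_integral_cmult[symmetric])
        (use measurable_compose[OF measurable_Pair1' pr] in simp)
    also have "\<dots> = (\<integral>\<^sup>+\<theta>. \<integral>\<^sup>+\<omega>. G (\<lambda>j\<in>{1..t}. p j \<omega>) * (\<Prod>j=k..s. ennreal (d \<theta> (p j \<omega>))) \<partial>M \<partial>\<mu>)"
      by (rule MM.Fubini'[symmetric])
        (use borel_measurable_times_ennreal[OF measurable_compose[OF measurable_fst Gp] pr] in
          \<open>simp add: case_prod_beta'\<close>)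
    finally show ?thesis .
  qed
  have "(\<integral>\<^sup>+\<omega>. G (\<lambda>j\<in>{1..t}. p j \<omega>) * (\<Prod>j=k..Suc t. ennreal (d \<theta> (p j \<omega>))) \<partial>M) =
    (\<integral>\<^sup>+\<omega>. G (\<lambda>j\<in>{1..t}. p j \<omega>) * (\<Prod>j=k..t. ennreal (d \<theta> (p j \<omega>))) \<partial>M)"
    if \<theta>: "\<theta> \<in> space \<mu>" for \<theta>
  proof -
    have den: "density_on_unit (d \<theta>)" using family \<theta> by (simp add: density_family_def)
    then have dm [measurable]: "d \<theta> \<in> borel_measurable borel" by (simp add: density_on_unit_def)
    let ?G = "\<lambda>y. G y * (\<Prod>j=k..t. ennreal (d \<theta> (y j)))"
    have "?G \<in> borel_measurable (PiM {1..t} (\<lambda>_. borel))"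
      using k by (intro borel_measurable_times_ennreal G borel_measurable_prod_ennreal
          measurable_compose[OF _ measurable_ennreal] measurable_compose[OF _ dm] measurable_component_singleton) auto
    from nn_integral_p_Suc[OF t this, of "\<lambda>v. ennreal (d \<theta> v)"]
    have "(\<integral>\<^sup>+\<omega>. ?G (\<lambda>j\<in>{1..t}. p j \<omega>) * ennreal (d \<theta> (p (Suc t) \<omega>)) \<partial>M) =
        (\<integral>\<^sup>+\<omega>. ?G (\<lambda>j\<in>{1..t}. p j \<omega>) \<partial>M)"
      by (simp add: nn_integral_density_on_unit[OF den])
    moreover have "(\<Prod>j=k..t. ennreal (d \<theta> ((\<lambda>j\<in>{1..t}. p j \<omega>) j))) = (\<Prod>j=k..t. ennreal (d \<theta> (p j \<omega>)))" for \<omega>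
      using k by (intro prod.cong) auto
    ultimately show ?thesis using k by (simp add: mult_ac)
  qed
  then show ?thesis unfolding swap by (rule nn_integral_cong)
qed

abbreviation S :: "nat \<Rightarrow> 'a \<Rightarrow> ennreal" where
  "S t \<omega> \<equiv> stat_S \<mu> d w (\<lambda>j. p j \<omega>) t"

text \<open>A predicate on p-value sequences and not on sample points, so that its indicator can
  serve as the test function \<open>G\<close>.\<close>

abbreviation not_stopped :: "nat \<Rightarrow> (nat \<Rightarrow> real) \<Rightarrow> bool" where
  "not_stopped t y \<equiv> \<forall>s\<in>{1..t}. stat_S \<mu> d w y s < ennreal b"

text \<open>A direct induction in place of optional stopping: the process is frozen at
  \<open>b\<close> once the threshold has been reached, and each time step raises its expectation by
  at most the capital \<open>w (Suc t)\<close> of the bet that opens then.\<close>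

lemma nn_integral_stopped_le:
  assumes "t \<le> T"
  shows "(\<integral>\<^sup>+\<omega>. (if not_stopped t (\<lambda>j. p j \<omega>) then S t \<omega> else ennreal b) \<partial>M) \<le> ennreal (cum_weight w t)"
  using assms
proof (induction t)
  case 0
  then show ?case by (simp add: stat_S_def)
next
  case (Suc t)
  let ?A = "\<lambda>\<omega>. not_stopped t (\<lambda>j. p j \<omega>)"
  let ?G = "\<lambda>y. if not_stopped t y then 1 else 0 :: ennreal"
  have Sm: "S s \<in> borel_measurable M" for s by (intro stat_S_measurable p_measurable)
  note [measurable] = Sm
  have SG: "(\<lambda>y. stat_S \<mu> d w y s) \<in> borel_measurable (PiM {1..t} (\<lambda>_. borel))" if "s \<in> {1..t}" for s
    using stat_S_measurable[of s "\<lambda>j y. y j" "PiM {1..t} (\<lambda>_. borel)" w] that by auto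
  have Gm: "?G \<in> borel_measurable (PiM {1..t} (\<lambda>_. borel))"
  proof (intro measurable_If measurable_const)
    have "{y \<in> space (PiM {1..t} (\<lambda>_. borel)). \<forall>s\<in>{1..t}. stat_S \<mu> d w y s < ennreal b} \<in> sets (PiM {1..t} (\<lambda>_. borel))"
      using SG by (intro sets.sets_Collect_finite_All borel_measurable_less) auto
    then show "{y \<in> space (PiM {1..t} (\<lambda>_. borel)). not_stopped t y} \<in> sets (PiM {1..t} (\<lambda>_. borel))" by simp
  qed auto
  have Gp: "?G (\<lambda>j\<in>{1..t}. p j \<omega>) = (if ?A \<omega> then 1 else 0)" for \<omega>
    using stat_S_cong[of _ "\<lambda>j\<in>{1..t}. p j \<omega>" "\<lambda>j. p j \<omega>" \<mu> d w] by auto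
  have wc: "cum_weight w (Suc t) = cum_weight w t + w (Suc t)" by (simp add: cum_weight_def)
  have W0: "cum_weight w t \<ge> 0" using w_nonneg by (auto simp: cum_weight_def intro!: sum_nonneg)
  have Ssum: "(\<integral>\<^sup>+\<omega>. (if ?A \<omega> then 1 else 0) * S (Suc t) \<omega> \<partial>M) =
      (\<integral>\<^sup>+\<omega>. (if ?A \<omega> then 1 else 0) * (S t \<omega> + ennreal (w (Suc t))) \<partial>M)"
  proof -
    have mm: "(\<lambda>\<omega>. (if ?A \<omega> then 1 else 0) * mixture_M \<mu> d (\<lambda>j. p j \<omega>) k s) \<in> borel_measurable M" for k s
      by (intro borel_measurable_times_ennreal mixture_M_measurable p_measurable) measurable
    have push: "(\<integral>\<^sup>+\<omega>. (if ?A \<omega> then 1 else 0) * (\<Sum>k=1..Suc t. ennreal (w k) * mixture_M \<mu> d (\<lambda>j. p j \<omega>) k s) \<partial>M) =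
        (\<Sum>k=1..Suc t. ennreal (w k) * (\<integral>\<^sup>+\<omega>. (if ?A \<omega> then 1 else 0) * mixture_M \<mu> d (\<lambda>j. p j \<omega>) k s \<partial>M))" for s
    proof -
      have "(\<integral>\<^sup>+\<omega>. (if ?A \<omega> then 1 else 0) * (\<Sum>k=1..Suc t. ennreal (w k) * mixture_M \<mu> d (\<lambda>j. p j \<omega>) k s) \<partial>M) =
        (\<integral>\<^sup>+\<omega>. (\<Sum>k=1..Suc t. ennreal (w k) * ((if ?A \<omega> then 1 else 0) * mixture_M \<mu> d (\<lambda>j. p j \<omega>) k s)) \<partial>M)"
        unfolding sum_distrib_left by (simp only: mult.left_commute)
      also have "\<dots> = (\<Sum>k=1..Suc t. \<integral>\<^sup>+\<omega>. ennreal (w k) * ((if ?A \<omega> then 1 else 0) * mixture_M \<mu> d (\<lambda>j. p j \<omega>) k s) \<partial>M)"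
        by (intro nn_integral_sum borel_measurable_times_ennreal[OF borel_measurable_const mm])
      finally show ?thesis by (simp only: nn_integral_cmult[OF mm])
    qed
    have "(\<integral>\<^sup>+\<omega>. (if ?A \<omega> then 1 else 0) * S (Suc t) \<omega> \<partial>M) =
        (\<Sum>k=1..Suc t. ennreal (w k) * (\<integral>\<^sup>+\<omega>. (if ?A \<omega> then 1 else 0) * mixture_M \<mu> d (\<lambda>j. p j \<omega>) k (Suc t) \<partial>M))"
      unfolding stat_S_def[of _ _ _ _ "Suc t"] by (rule push)
    also have "\<dots> = (\<Sum>k=1..Suc t. ennreal (w k) * (\<integral>\<^sup>+\<omega>. (if ?A \<omega> then 1 else 0) * mixture_M \<mu> d (\<lambda>j. p j \<omega>) k t \<partial>M))"
      using nn_integral_mixture_Suc[OF Suc.prems Gm] unfolding Gp by (intro sum.cong refl arg_cong2[of _ _ _ _ "(*)"]) auto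
    also have "\<dots> = (\<integral>\<^sup>+\<omega>. (if ?A \<omega> then 1 else 0) * (\<Sum>k=1..Suc t. ennreal (w k) * mixture_M \<mu> d (\<lambda>j. p j \<omega>) k t) \<partial>M)"
      by (rule push[symmetric])
    finally show ?thesis by (simp add: stat_S_def)
  qed
  have "(\<integral>\<^sup>+\<omega>. (if not_stopped (Suc t) (\<lambda>j. p j \<omega>) then S (Suc t) \<omega> else ennreal b) \<partial>M) \<le>
      (\<integral>\<^sup>+\<omega>. (if ?A \<omega> then 1 else 0) * S (Suc t) \<omega> + (if ?A \<omega> then 0 else ennreal b) \<partial>M)"
    by (intro nn_integral_mono) (fastforce simp: not_less atLeastAtMostSuc_conv)
  also have "\<dots> = (\<integral>\<^sup>+\<omega>. (if ?A \<omega> then 1 else 0) * S (Suc t) \<omega> \<partial>M) + (\<integral>\<^sup>+\<omega>. (if ?A \<omega> then 0 else ennreal b) \<partial>M)"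
    by (intro nn_integral_add) measurable
  also have "\<dots> = (\<integral>\<^sup>+\<omega>. (if ?A \<omega> then 1 else 0) * (S t \<omega> + ennreal (w (Suc t))) + (if ?A \<omega> then 0 else ennreal b) \<partial>M)"
    unfolding Ssum by (intro nn_integral_add[symmetric]) measurable
  \<comment> \<open>The new capital is granted on the stopped paths as well, which makes the
    increment of the bound deterministic.\<close>
  also have "\<dots> \<le> (\<integral>\<^sup>+\<omega>. (if ?A \<omega> then S t \<omega> else ennreal b) + ennreal (w (Suc t)) \<partial>M)"
    by (intro nn_integral_mono) auto
  also have "\<dots> = (\<integral>\<^sup>+\<omega>. (if ?A \<omega> then S t \<omega> else ennreal b) \<partial>M) + ennreal (w (Suc t))"
    by (subst nn_integral_add) (measurable, simp add: emeasure_space_1)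
  also have "\<dots> \<le> ennreal (cum_weight w t) + ennreal (w (Suc t))"
    using Suc by (intro add_mono) auto
  also have "\<dots> = ennreal (cum_weight w (Suc t))"
    using W0 w_nonneg[of "Suc t"] by (simp add: wc ennreal_plus)
  finally show ?case .
qed

lemma prob_not_stopped_ge:
  "prob {\<omega>\<in>space M. not_stopped T (\<lambda>j. p j \<omega>)} \<ge> survival_bound w T b"
proof -
  have [measurable]: "S s \<in> borel_measurable M" for s by (intro stat_S_measurable p_measurable)
  let ?N = "{\<omega>\<in>space M. \<not> not_stopped T (\<lambda>j. p j \<omega>)}"
  have N [measurable]: "?N \<in> sets M" by measurable
  have W0: "cum_weight w T \<ge> 0" using w_nonneg by (auto simp: cum_weight_def intro!: sum_nonneg)
  have "ennreal b * emeasure M ?N = (\<integral>\<^sup>+\<omega>. ennreal b * indicator ?N \<omega> \<partial>M)"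
    by (simp add: nn_integral_cmult_indicator)
  also have "\<dots> \<le> (\<integral>\<^sup>+\<omega>. (if not_stopped T (\<lambda>j. p j \<omega>) then S T \<omega> else ennreal b) \<partial>M)"
    by (intro nn_integral_mono) (auto simp: indicator_def)
  also have "\<dots> \<le> ennreal (cum_weight w T)" by (rule nn_integral_stopped_le) simp
  finally have "b * prob ?N \<le> cum_weight w T"
    using b_pos W0 by (simp add: emeasure_eq_measure ennreal_mult[symmetric])
  then have "prob ?N \<le> cum_weight w T / b" using b_pos by (simp add: field_simps)
  moreover have "prob ?N = 1 - prob {\<omega>\<in>space M. not_stopped T (\<lambda>j. p j \<omega>)}"
    using prob_neg[of "\<lambda>\<omega>. not_stopped T (\<lambda>j. p j \<omega>)"] by simp
  ultimately show ?thesis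
    using prob_le_1[of ?N] by (simp add: survival_bound_def min_def)
qed

end

subsection \<open>Post-change p-values\<close>

lemma (in prob_space) indep_var_prob_le:
  assumes ind: "indep_var S A R B"
    and \<Phi>: "{z \<in> space (S \<Otimes>\<^sub>M R). \<Phi> (fst z) (snd z)} \<in> sets (S \<Otimes>\<^sub>M R)"
    and le: "AE \<omega> in M. prob {\<omega>'\<in>space M. \<Phi> (A \<omega>') (B \<omega>)} \<le> c" and c: "c \<ge> 0"
  shows "prob {\<omega>\<in>space M. \<Phi> (A \<omega>) (B \<omega>)} \<le> c"
proof -
  have A: "A \<in> measurable M S" and B: "B \<in> measurable M R"
    using ind by (auto dest: indep_var_rv1 indep_var_rv2)
  have eq: "distr M S A \<Otimes>\<^sub>M distr M R B = distr M (S \<Otimes>\<^sub>M R) (\<lambda>\<omega>. (A \<omega>, B \<omega>))"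
    using ind by (simp add: indep_var_distribution_eq)
  have AB: "(\<lambda>\<omega>. (A \<omega>, B \<omega>)) \<in> measurable M (S \<Otimes>\<^sub>M R)" using A B by measurable
  interpret DA: prob_space "distr M S A" by (rule prob_space_distr[OF A])
  interpret DB: prob_space "distr M R B" by (rule prob_space_distr[OF B])
  interpret PP: pair_sigma_finite "distr M S A" "distr M R B" by unfold_locales
  let ?Z = "{z \<in> space (S \<Otimes>\<^sub>M R). \<Phi> (fst z) (snd z)}"
  have Z: "?Z \<in> sets (distr M S A \<Otimes>\<^sub>M distr M R B)" using \<Phi> by (simp add: eq)
  have "emeasure M {\<omega>\<in>space M. \<Phi> (A \<omega>) (B \<omega>)} = emeasure (distr M (S \<Otimes>\<^sub>M R) (\<lambda>\<omega>. (A \<omega>, B \<omega>))) ?Z"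
    using measurable_space[OF AB]
    by (subst emeasure_distr[OF AB \<Phi>]) (auto intro!: arg_cong[of _ _ "emeasure M"])
  also have "\<dots> = (\<integral>\<^sup>+y. emeasure (distr M S A) ((\<lambda>x. (x, y)) -` ?Z) \<partial>distr M R B)"
    unfolding eq[symmetric] by (rule PP.emeasure_pair_measure_alt2[OF Z])
  also have "\<dots> = (\<integral>\<^sup>+\<omega>. emeasure (distr M S A) ((\<lambda>x. (x, B \<omega>)) -` ?Z) \<partial>M)"
    by (rule nn_integral_distr[OF B PP.measurable_emeasure_Pair2[OF Z]])
  also have "\<dots> \<le> (\<integral>\<^sup>+\<omega>. ennreal c \<partial>M)"
  proof (rule nn_integral_mono_AE)
    show "AE \<omega> in M. emeasure (distr M S A) ((\<lambda>x. (x, B \<omega>)) -` ?Z) \<le> ennreal c"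
      using le AE_space
    proof eventually_elim
      fix \<omega> assume *: "prob {\<omega>'\<in>space M. \<Phi> (A \<omega>') (B \<omega>)} \<le> c" "\<omega> \<in> space M"
      have "(\<lambda>x. (x, B \<omega>)) -` ?Z \<in> sets S" using sets_Pair2[OF \<Phi>] .
      then have "emeasure (distr M S A) ((\<lambda>x. (x, B \<omega>)) -` ?Z) = emeasure M {\<omega>'\<in>space M. \<Phi> (A \<omega>') (B \<omega>)}"
        using measurable_space[OF A] measurable_space[OF B *(2)]
        by (subst emeasure_distr[OF A]) (auto simp: space_pair_measure intro!: arg_cong[of _ _ "emeasure M"])
      then show "emeasure (distr M S A) ((\<lambda>x. (x, B \<omega>)) -` ?Z) \<le> ennreal c"
        using * c by (simp add: emeasure_eq_measure)
    qed
  qed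
  also have "\<dots> = ennreal c" by (simp add: emeasure_space_1)
  finally show ?thesis using c by (simp add: emeasure_eq_measure)
qed

text \<open>The contribution of one observation \<open>x\<close> to the rank of \<open>y\<close>: a
  randomized comparison with values in the unit interval when \<open>u\<close> lies there, as
  Hoeffding's inequality needs.\<close>

definition rank_weight :: "real \<Rightarrow> real \<Rightarrow> real \<Rightarrow> real" where
  "rank_weight x y u = of_bool (x < y) + u * of_bool (x = y)"

lemma rank_weight_bounds: "u \<in> {0..1} \<Longrightarrow> rank_weight x y u \<in> {0..1}"
  by (auto simp: rank_weight_def of_bool_def)

lemma conformal_p_eq_sum: "conformal_p x u j = (\<Sum>i=1..j. rank_weight (x i) (x j) (u j)) / real j"
  by (simp add: conformal_p_def rank_weight_def sum.distrib sum_distrib_left)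

lemma conformal_p_in_unit:
  assumes "u j \<in> {0..1}"
  shows "conformal_p x u j \<in> {0..1}"
proof (cases "j = 0")
  case True
  then show ?thesis by (simp add: conformal_p_def)
next
  case False
  have "(\<Sum>i=1..j. rank_weight (x i) (x j) (u j)) \<le> (\<Sum>i=1..j. 1)"
    using rank_weight_bounds[OF assms] by (intro sum_mono) simp
  moreover have "0 \<le> (\<Sum>i=1..j. rank_weight (x i) (x j) (u j))"
    using rank_weight_bounds[OF assms] by (intro sum_nonneg) simp
  ultimately show ?thesis using False by (simp add: conformal_p_eq_sum)
qed

text \<open>Only the first \<open>T\<close> terms matter up to an error that is small when \<open>j - T\<close> is small.\<close>

lemma conformal_p_approx:
  fixes T j m :: nat
  assumes u: "u j \<in> {0..1}" and T: "1 \<le> T" and j: "T < j" "j \<le> T + m"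
  shows "\<bar>conformal_p x u j - (\<Sum>i=1..T. rank_weight (x i) (x j) (u j)) / T\<bar> \<le> m / T"
proof -
  let ?r = "\<lambda>i. rank_weight (x i) (x j) (u j)"
  define a where "a = (\<Sum>i=1..T. ?r i)"
  define c where "c = (\<Sum>i=T+1..j. ?r i)"
  have "(\<Sum>i=1..j. ?r i) = a + c"
    unfolding a_def c_def using j sum.ub_add_nat[of 1 T ?r "j - T"] by simp
  then have p: "conformal_p x u j = (a + c) / j" by (simp add: conformal_p_eq_sum)
  have r: "0 \<le> ?r i" "?r i \<le> 1" for i using rank_weight_bounds[OF u] by auto
  have a: "0 \<le> a" "a \<le> T"
    unfolding a_def using sum_mono[of "{1..T}" ?r "\<lambda>_. 1"] r by (auto intro: sum_nonneg)
  have c: "0 \<le> c" "c \<le> real j - T"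
    unfolding c_def using sum_mono[of "{T+1..j}" ?r "\<lambda>_. 1"] r j by (auto intro: sum_nonneg simp: of_nat_diff)
  have Tj: "0 < real T" "real T < real j" "real j \<le> real T + m" using T j by auto
  \<comment> \<open>\<open>q\<close> is what the last \<open>j - T\<close> terms would contribute if
    their average were that of the first \<open>T\<close>. Both \<open>c\<close> and
    \<open>q\<close> lie between 0 and \<open>j - T\<close>, hence differ by at most
    \<open>m\<close>.\<close>
  define q where "q = (real j - T) * (a / T)"
  have e: "(a + c) / j - a / T = (c - q) / j"
    unfolding q_def using Tj by (simp add: field_simps)
  have "0 \<le> a / T" "a / T \<le> 1" using a Tj by auto
  then have "0 \<le> q" "q \<le> (real j - T) * 1"
    unfolding q_def using Tj by (intro mult_nonneg_nonneg mult_left_mono; simp)+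
  then have "c - q \<le> m" "q - c \<le> m" using c Tj by (simp_all add: algebra_simps)
  then have "\<bar>c - q\<bar> \<le> m" by (intro abs_leI) auto
  then have "\<bar>c - q\<bar> / j \<le> m / T"
    using Tj by (intro frac_le) auto
  then show ?thesis unfolding p a_def[symmetric] e using Tj by (simp add: abs_divide)
qed

context changepoint
begin

lemma AE_U: "j \<ge> 1 \<Longrightarrow> AE \<omega> in M. U j \<omega> \<in> {0..1}"
proof -
  assume j: "j \<ge> 1"
  have "AE v in unif. v \<in> {0..1}"
    by (intro AE_uniform_measureI) auto
  then have "AE v in distr M borel (U j). v \<in> {0..1}" by (simp only: distr_U[OF j])
  then show ?thesis using j by (subst (asm) AE_distr_iff) (auto intro: U_measurable)
qed

text \<open>For a frozen threshold the terms are independent with values in the unit interval. Ties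
  with \<open>y\<close> are null under \<open>P0\<close>, so the randomizer drops out and every term
  has mean \<open>cdf P0 y\<close>.\<close>

lemma prob_rank_fixed:
  fixes \<epsilon> :: real
  assumes T: "T \<ge> 1" and u: "u \<in> {0..1}" and \<epsilon>: "\<epsilon> > 0"
  shows "prob {\<omega>\<in>space M. \<bar>(\<Sum>i=1..T. rank_weight (X i \<omega>) y u) - T * cdf P0 y\<bar> \<ge> T * \<epsilon>} \<le> 2 * exp (-2 * real T * \<epsilon>\<^sup>2)"
proof -
  have rm [measurable]: "(\<lambda>x. rank_weight x y u) \<in> borel_measurable borel"
    unfolding rank_weight_def by measurable
  have ex: "expectation (\<lambda>\<omega>. rank_weight (X i \<omega>) y u) = cdf P0 y" if i: "i \<in> {1..T}" for i
  proof -
    have "expectation (\<lambda>\<omega>. rank_weight (X i \<omega>) y u) = (\<integral>x. rank_weight x y u \<partial>distr M borel (X i))"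
      using i by (intro integral_distr[symmetric] X_measurable) auto
    also have "distr M borel (X i) = P0" using i distr_X[of i] by simp
    also have "(\<integral>x. rank_weight x y u \<partial>P0) = (\<integral>x. indicator {..y} x \<partial>P0)"
    proof (rule integral_cong_AE)
      have "AE x in P0. x \<noteq> y" using P0.atomless[of y] by (intro AE_not_in[of "{y}", simplified]) (auto simp: null_sets_def)
      then show "AE x in P0. rank_weight x y u = indicator {..y} x"
        by eventually_elim (auto simp: rank_weight_def indicator_def)
    qed auto
    finally show ?thesis by (simp add: cdf_def)
  qed
  interpret H: Hoeffding_ineq M "{1..T}" "\<lambda>i \<omega>. rank_weight (X i \<omega>) y u" "\<lambda>_. 0" "\<lambda>_. 1" "T * cdf P0 y"
  proof unfold_locales
    show "indep_vars (\<lambda>_. borel) (\<lambda>i \<omega>. rank_weight (X i \<omega>) y u) {1..T}"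
      by (rule indep_vars_compose2[OF indep_vars_X]) auto
    show "AE \<omega> in M. rank_weight (X i \<omega>) y u \<in> {0..1}" for i
      using rank_weight_bounds[OF u] by simp
    show "T * cdf P0 y \<equiv> \<Sum>i = 1..T. expectation (\<lambda>\<omega>. rank_weight (X i \<omega>) y u)"
      by (rule eq_reflection) (simp add: ex del: One_nat_def)
  qed auto
  have "-2 * (T * \<epsilon>)\<^sup>2 / (\<Sum>i\<in>{1..T}. (1 - 0)\<^sup>2) = -2 * real T * \<epsilon>\<^sup>2"
    using T by (simp add: power2_eq_square)
  then show ?thesis using H.Hoeffding_ineq_abs_ge[of "T * \<epsilon>"] T \<epsilon> by simp
qed

text \<open>\<open>X j\<close> and \<open>U j\<close> are independent of the first \<open>T\<close>
  observations, so they may be frozen, and the bound for frozen values does not depend on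
  them.\<close>

lemma prob_rank_post:
  fixes \<epsilon> :: real
  assumes T: "T \<ge> 1" and j: "j > T" and \<epsilon>: "\<epsilon> > 0"
  shows "prob {\<omega>\<in>space M. \<bar>(\<Sum>i=1..T. rank_weight (X i \<omega>) (X j \<omega>) (U j \<omega>)) - T * cdf P0 (X j \<omega>)\<bar> \<ge> T * \<epsilon>}
    \<le> 2 * exp (-2 * real T * \<epsilon>\<^sup>2)"
proof -
  let ?S = "PiM {1..T} (\<lambda>_. borel :: real measure)"
  \<comment> \<open>The pair of \<open>X j\<close> and \<open>U j\<close> is coded as a function on
    \<open>{0, 1}\<close> so that it has the same type as the pre-change sample, as
    \<open>indep_var\<close> requires.\<close>
  let ?R = "PiM {0, 1} (\<lambda>_. borel :: real measure) :: (nat \<Rightarrow> real) measure"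
  let ?B = "\<lambda>x u. \<lambda>i\<in>{0, 1::nat}. if i = 0 then x else u :: real"
  have "indep_var (PiM (Inl ` {1..T}) (\<lambda>_. borel)) (\<lambda>\<omega>. restrict (\<lambda>i. case_sum X U i \<omega>) (Inl ` {1..T}))
      (PiM {Inl j, Inr j} (\<lambda>_. borel)) (\<lambda>\<omega>. restrict (\<lambda>i. case_sum X U i \<omega>) {Inl j, Inr j})"
    using j by (intro indep_var_restrict[OF indep]) auto
  moreover have "(\<lambda>z. \<lambda>i\<in>{1..T}. z (Inl i)) \<in> measurable (PiM (Inl ` {1..T}) (\<lambda>_. borel)) ?S"
    by (intro measurable_restrict measurable_component_singleton) auto
  moreover have "(\<lambda>z. ?B (z (Inl j)) (z (Inr j))) \<in> measurable (PiM {Inl j, Inr j} (\<lambda>_. borel)) ?R"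
    by (intro measurable_restrict) auto
  ultimately have "indep_var ?S
      ((\<lambda>z. \<lambda>i\<in>{1..T}. z (Inl i)) \<circ> (\<lambda>\<omega>. restrict (\<lambda>i. case_sum X U i \<omega>) (Inl ` {1..T})))
      ?R ((\<lambda>z. ?B (z (Inl j)) (z (Inr j))) \<circ> (\<lambda>\<omega>. restrict (\<lambda>i. case_sum X U i \<omega>) {Inl j, Inr j}))"
    by (rule indep_var_compose)
  then have ind: "indep_var ?S (\<lambda>\<omega>. \<lambda>i\<in>{1..T}. X i \<omega>) ?R (\<lambda>\<omega>. ?B (X j \<omega>) (U j \<omega>))"
    by (simp add: o_def restrict_def if_distrib cong: if_cong)
  have F [measurable]: "cdf P0 \<in> borel_measurable borel"
    by (intro borel_measurable_mono monoI P0.cdf_nondecreasing)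
  let ?\<Phi> = "\<lambda>x z. T * \<epsilon> \<le> \<bar>(\<Sum>i=1..T. rank_weight (x i) (z 0) (z 1)) - T * cdf P0 (z 0)\<bar>"
  have zm: "(\<lambda>z. snd z k) \<in> borel_measurable (?S \<Otimes>\<^sub>M ?R)" if "k \<in> {0, 1}" for k
    by (rule measurable_compose[OF measurable_snd measurable_component_singleton[OF that]])
  have "(\<lambda>z. rank_weight (fst z i) (snd z 0) (snd z 1)) \<in> borel_measurable (?S \<Otimes>\<^sub>M ?R)" if "i \<in> {1..T}" for i
  proof -
    have fm: "(\<lambda>z. fst z i) \<in> borel_measurable (?S \<Otimes>\<^sub>M ?R)"
      by (rule measurable_compose[OF measurable_fst measurable_component_singleton[OF that]])
    have "(\<lambda>z. of_bool (f z < g z) + h z * of_bool (f z = g z)) \<in> borel_measurable N"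
      if [measurable]: "f \<in> borel_measurable N" "g \<in> borel_measurable N" "h \<in> borel_measurable N"
      for f g h :: "_ \<Rightarrow> real" and N :: "((nat \<Rightarrow> real) \<times> (nat \<Rightarrow> real)) measure" by measurable
    from this[OF fm zm zm] show ?thesis unfolding rank_weight_def by blast
  qed
  then have 1: "(\<lambda>z. \<Sum>i=1..T. rank_weight (fst z i) (snd z 0) (snd z 1)) \<in> borel_measurable (?S \<Otimes>\<^sub>M ?R)"
    by (intro borel_measurable_sum)
  have 2: "(\<lambda>z. cdf P0 (snd z 0)) \<in> borel_measurable (?S \<Otimes>\<^sub>M ?R)"
    by (rule measurable_compose[OF zm F], simp)
  have meas: "{z \<in> space (?S \<Otimes>\<^sub>M ?R). ?\<Phi> (fst z) (snd z)} \<in> sets (?S \<Otimes>\<^sub>M ?R)"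
    by (intro borel_measurable_le borel_measurable_const borel_measurable_abs borel_measurable_diff
        borel_measurable_times 1 2)
  have "AE \<omega> in M. prob {\<omega>'\<in>space M. ?\<Phi> (\<lambda>i\<in>{1..T}. X i \<omega>') (?B (X j \<omega>) (U j \<omega>))} \<le> 2 * exp (-2 * real T * \<epsilon>\<^sup>2)"
    using AE_U[OF order.trans[OF T less_imp_le[OF j]]]
  proof eventually_elim
    case (elim \<omega>)
    then show ?case using prob_rank_fixed[OF T _ \<epsilon>, of "U j \<omega>" "X j \<omega>"] by simp
  qed
  from indep_var_prob_le[where \<Phi> = ?\<Phi>, OF ind meas this] show ?thesis by simp
qed

text \<open>The values \<open>cdf P0 (X j)\<close> after the change are independent with common law.
  Each term ranges over an interval of length \<open>2 * B\<close>, so the squared lengths add up to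
  \<open>4 * m * B\<^sup>2\<close>, which gives the exponent.\<close>

lemma prob_sum_post:
  fixes g :: "real \<Rightarrow> real" and \<epsilon> :: real
  assumes g: "g \<in> borel_measurable borel" and bd: "\<And>u. u \<in> {0..1} \<Longrightarrow> \<bar>g u\<bar> \<le> B"
    and B: "B > 0" and m: "m \<ge> 1" and \<epsilon>: "\<epsilon> > 0"
  shows "prob {\<omega>\<in>space M. (\<Sum>j=T+1..T+m. g (cdf P0 (X j \<omega>))) \<le> m * (LINT y|P1. g (cdf P0 y)) - m * \<epsilon>}
    \<le> exp (- (m * \<epsilon>\<^sup>2 / (2 * B\<^sup>2)))"
proof -
  let ?I = "LINT y|P1. g (cdf P0 y)"
  have F: "cdf P0 \<in> borel_measurable borel"
    by (intro borel_measurable_mono monoI P0.cdf_nondecreasing)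
  have gF: "(\<lambda>y. g (cdf P0 y)) \<in> borel_measurable borel"
    by (rule measurable_compose[OF F g])
  have ex: "expectation (\<lambda>\<omega>. g (cdf P0 (X j \<omega>))) = ?I" if j: "j \<in> {T+1..T+m}" for j
  proof -
    have "expectation (\<lambda>\<omega>. g (cdf P0 (X j \<omega>))) = (\<integral>y. g (cdf P0 y) \<partial>distr M borel (X j))"
      using j by (intro integral_distr[symmetric] X_measurable gF) auto
    also have "distr M borel (X j) = P1" using j distr_X[of j] by simp
    finally show ?thesis .
  qed
  interpret H: Hoeffding_ineq M "{T+1..T+m}" "\<lambda>j \<omega>. g (cdf P0 (X j \<omega>))" "\<lambda>_. -B" "\<lambda>_. B" "m * ?I"
  proof unfold_locales
    show "indep_vars (\<lambda>_. borel) (\<lambda>j \<omega>. g (cdf P0 (X j \<omega>))) {T+1..T+m}"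
      by (rule indep_vars_compose2[OF indep_vars_X]) (use gF in auto)
    show "AE \<omega> in M. g (cdf P0 (X j \<omega>)) \<in> {-B..B}" for j
    proof (rule AE_I2)
      fix \<omega>
      show "g (cdf P0 (X j \<omega>)) \<in> {-B..B}"
        using bd[of "cdf P0 (X j \<omega>)"] P0.cdf_nonneg[of "X j \<omega>"] P0.cdf_bounded_prob[of "X j \<omega>"]
        by (auto simp: abs_le_iff)
    qed
    show "m * ?I \<equiv> \<Sum>j\<in>{T+1..T+m}. expectation (\<lambda>\<omega>. g (cdf P0 (X j \<omega>)))"
      by (rule eq_reflection) (simp add: ex del: One_nat_def)
  qed auto
  have s: "(\<Sum>i\<in>{T+1..T+m}. (B - - B)\<^sup>2) = 4 * m * B\<^sup>2" by (simp add: power2_eq_square)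
  have "-2 * (m * \<epsilon>)\<^sup>2 / (4 * m * B\<^sup>2) = - (m * \<epsilon>\<^sup>2 / (2 * B\<^sup>2))"
    using m B by (simp add: power2_eq_square)
  with H.Hoeffding_ineq_le[of "m * \<epsilon>", unfolded s] m B \<epsilon> show ?thesis by simp
qed

lemma AE_U_all: "AE \<omega> in M. \<forall>j\<in>{1..}. U j \<omega> \<in> {0..1}"
  by (subst AE_ball_countable) (auto simp del: atLeastAtMost_iff intro: AE_U)

lemma AE_p: "AE \<omega> in M. \<forall>j\<in>{1..}. p j \<omega> \<in> {0..1}"
  using AE_U_all
proof eventually_elim
  case (elim \<omega>)
  show ?case
  proof
    fix j :: nat assume "j \<in> {1..}"
    with elim have "U j \<omega> \<in> {0..1}" by blast
    then show "p j \<omega> \<in> {0..1}" by (rule conformal_p_in_unit)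
  qed
qed

text \<open>Hoeffding's inequality does not apply to the dependent p-values themselves, so the sum
  is compared with that of the independent \<open>g (cdf P0 (X j))\<close>. Per term the comparison
  costs \<open>L\<close> times the sampling error \<open>\<epsilon>\<close> of the pre-change ranks
  plus the contamination \<open>m / T\<close>. The first error probability is a union bound over the
  window, the second is the fluctuation of the independent sum.\<close>

lemma prob_log_growth_ge:
  fixes g :: "real \<Rightarrow> real" and \<epsilon> :: real
  assumes g: "g \<in> borel_measurable borel" and bd: "\<And>u. u \<in> {0..1} \<Longrightarrow> \<bar>g u\<bar> \<le> B"
    and lip: "L-lipschitz_on {0..1} g"
    and B: "B > 0" and T: "T \<ge> 1" and m: "m \<ge> 1" and \<epsilon>: "\<epsilon> > 0"
  shows "prob {\<omega>\<in>space M. m * ((LINT y|P1. g (cdf P0 y)) - \<epsilon> - L * (\<epsilon> + m / T)) < (\<Sum>j=T+1..T+m. g (p j \<omega>))}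
    \<ge> 1 - 2 * real m * exp (-2 * real T * \<epsilon>\<^sup>2) - exp (- (m * \<epsilon>\<^sup>2 / (2 * B\<^sup>2)))"
proof -
  let ?I = "LINT y|P1. g (cdf P0 y)"
  let ?J = "{T+1..T+m}"
  let ?a = "\<lambda>j \<omega>. \<Sum>i=1..T. rank_weight (X i \<omega>) (X j \<omega>) (U j \<omega>)"
  let ?E = "\<lambda>j. {\<omega>\<in>space M. \<bar>?a j \<omega> - T * cdf P0 (X j \<omega>)\<bar> \<ge> T * \<epsilon>}"
  let ?D = "{\<omega>\<in>space M. (\<Sum>j=T+1..T+m. g (cdf P0 (X j \<omega>))) \<le> m * ?I - m * \<epsilon>}"
  let ?G = "{\<omega>\<in>space M. m * (?I - \<epsilon> - L * (\<epsilon> + m / T)) < (\<Sum>j=T+1..T+m. g (p j \<omega>))}"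
  have L: "L \<ge> 0" using lip by (rule lipschitz_on_nonneg)
  have F: "cdf P0 \<in> borel_measurable borel"
    by (intro borel_measurable_mono monoI P0.cdf_nondecreasing)
  have rw: "(\<lambda>\<omega>. rank_weight (X i \<omega>) (X j \<omega>) (U j \<omega>)) \<in> borel_measurable M" if "i \<ge> 1" "j \<ge> 1" for i j
  proof -
    have [measurable]: "X i \<in> borel_measurable M" "X j \<in> borel_measurable M" "U j \<in> borel_measurable M"
      using that by (auto intro: X_measurable U_measurable)
    show ?thesis unfolding rank_weight_def by measurable
  qed
  have E: "?E j \<in> sets M" if "j \<in> ?J" for j
    using that by (intro borel_measurable_le borel_measurable_const borel_measurable_abs borel_measurable_diff
        borel_measurable_times borel_measurable_sum rw measurable_compose[OF X_measurable F]) auto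
  have D: "?D \<in> sets M"
    by (intro borel_measurable_le borel_measurable_const borel_measurable_sum
        measurable_compose[OF measurable_compose[OF X_measurable F] g]) auto
  have G: "?G \<in> sets M"
    by (intro borel_measurable_less borel_measurable_const borel_measurable_sum measurable_compose[OF p_measurable g])
  have UE: "(\<Union>j\<in>?J. ?E j) \<in> sets M" using E by (intro sets.finite_UN) auto
  have "AE \<omega> in M. \<omega> \<in> space M - ?G \<longrightarrow> \<omega> \<in> (\<Union>j\<in>?J. ?E j) \<union> ?D"
  proof -
    show ?thesis using AE_U_all
    proof eventually_elim
      fix \<omega> assume U: "\<forall>j\<in>{1..}. U j \<omega> \<in> {0..1}"
      have "\<omega> \<in> ?G" if \<omega>: "\<omega> \<in> space M" "\<omega> \<notin> (\<Union>j\<in>?J. ?E j)" "\<omega> \<notin> ?D"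
      proof -
        have "g (cdf P0 (X j \<omega>)) - L * (\<epsilon> + m / T) \<le> g (p j \<omega>)" if j: "j \<in> ?J" for j
        proof -
          have Uj: "U j \<omega> \<in> {0..1}" using U j by auto
          have "\<bar>?a j \<omega> - T * cdf P0 (X j \<omega>)\<bar> < T * \<epsilon>" using \<omega> j by (auto simp: not_le)
          then have "\<bar>?a j \<omega> / T - cdf P0 (X j \<omega>)\<bar> < \<epsilon>"
            using T by (simp add: abs_less_iff field_simps)
          moreover have "\<bar>p j \<omega> - ?a j \<omega> / T\<bar> \<le> m / T"
            using conformal_p_approx[where u = "\<lambda>j. U j \<omega>" and x = "\<lambda>j. X j \<omega>" and j = j, OF Uj T] j by simp
          ultimately have close: "\<bar>p j \<omega> - cdf P0 (X j \<omega>)\<bar> \<le> \<epsilon> + m / T" by linarith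
          have "\<bar>g (p j \<omega>) - g (cdf P0 (X j \<omega>))\<bar> \<le> L * \<bar>p j \<omega> - cdf P0 (X j \<omega>)\<bar>"
            using lipschitz_onD[OF lip conformal_p_in_unit[where u = "\<lambda>j. U j \<omega>", OF Uj, of "\<lambda>j. X j \<omega>"], of "cdf P0 (X j \<omega>)"]
              P0.cdf_nonneg[of "X j \<omega>"] P0.cdf_bounded_prob[of "X j \<omega>"]
            by (simp add: dist_real_def)
          also have "\<dots> \<le> L * (\<epsilon> + m / T)" using close L by (rule mult_left_mono)
          finally show ?thesis by linarith
        qed
        then have "(\<Sum>j\<in>?J. g (cdf P0 (X j \<omega>)) - L * (\<epsilon> + m / T)) \<le> (\<Sum>j\<in>?J. g (p j \<omega>))"
          by (rule sum_mono)
        moreover have "(\<Sum>j\<in>?J. g (cdf P0 (X j \<omega>))) > m * ?I - m * \<epsilon>"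
          using \<omega> by (simp add: not_le)
        ultimately show ?thesis using \<omega>(1) by (simp add: sum_subtractf algebra_simps)
      qed
      then show "\<omega> \<in> space M - ?G \<longrightarrow> \<omega> \<in> (\<Union>j\<in>?J. ?E j) \<union> ?D" by blast
    qed
  qed
  then have "prob (space M - ?G) \<le> prob ((\<Union>j\<in>?J. ?E j) \<union> ?D)"
    using UE D by (intro finite_measure_mono_AE sets.Un) auto
  also have "\<dots> \<le> prob (\<Union>j\<in>?J. ?E j) + prob ?D" using UE D by (rule measure_Un_le)
  also have "\<dots> \<le> (\<Sum>j\<in>?J. prob (?E j)) + prob ?D"
    using E by (intro add_right_mono finite_measure_subadditive_finite) auto
  also have "\<dots> \<le> (\<Sum>j\<in>?J. 2 * exp (-2 * real T * \<epsilon>\<^sup>2)) + exp (- (m * \<epsilon>\<^sup>2 / (2 * B\<^sup>2)))"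
    by (intro add_mono sum_mono prob_rank_post prob_sum_post) (use assms in auto)
  finally have "prob (space M - ?G) \<le> 2 * real m * exp (-2 * real T * \<epsilon>\<^sup>2) + exp (- (m * \<epsilon>\<^sup>2 / (2 * B\<^sup>2)))"
    by simp
  then show ?thesis using prob_compl[OF G] by simp
qed

end

subsection \<open>Detection times\<close>

lemma INF_enat_attained:
  assumes "A \<noteq> {}"
  obtains k where "k \<in> A" "(INF t\<in>A. enat t) = enat k"
proof -
  have "(INF t\<in>A. enat t) \<in> enat ` A"
    using assms by (metis wellorder_InfI ex_in_conv imageI)
  then show ?thesis using that by auto
qed

text \<open>Connects an extended stopping time with a real deadline: a finite bound excludes the
  empty set, and a nonempty set of naturals attains its infimum.\<close>

lemma INF_enat_le_ereal_iff:
  "ereal_of_enat (INF t\<in>A. enat t) \<le> ereal c \<longleftrightarrow> (\<exists>t\<in>A. real t \<le> c)"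
proof
  assume *: "ereal_of_enat (INF t\<in>A. enat t) \<le> ereal c"
  then have "A \<noteq> {}" by (auto simp: top_enat_def)
  from INF_enat_attained[OF this] * show "\<exists>t\<in>A. real t \<le> c" by (metis ereal_of_enat_simps(1) ereal_less_eq(3))
next
  assume "\<exists>t\<in>A. real t \<le> c"
  then obtain t where t: "t \<in> A" "real t \<le> c" by blast
  then have "(INF t\<in>A. enat t) \<le> enat t" by (intro INF_lower)
  then have "ereal_of_enat (INF t\<in>A. enat t) \<le> ereal_of_enat (enat t)" by (simp only: ereal_of_enat_le_iff)
  also have "\<dots> \<le> ereal c" using t by simp
  finally show "ereal_of_enat (INF t\<in>A. enat t) \<le> ereal c" .
qed

lemma less_INF_enat_iff: "enat n < (INF t\<in>A. enat t) \<longleftrightarrow> (\<forall>t\<in>A. n < t)"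
proof (cases "A = {}")
  case True
  then show ?thesis by (simp add: top_enat_def)
next
  case False
  then obtain k where "k \<in> A" "(INF t\<in>A. enat t) = enat k" by (rule INF_enat_attained)
  moreover have "(INF t\<in>A. enat t) \<le> enat t" if "t \<in> A" for t using that by (rule INF_lower)
  ultimately show ?thesis by (auto intro: less_le_trans)
qed

lemma measurable_INF_enat:
  assumes "\<And>t. {\<omega>\<in>space M. P t \<omega>} \<in> sets M"
  shows "(\<lambda>\<omega>. INF t\<in>{t. P t \<omega>}. enat t) \<in> measurable M (count_space UNIV)"
proof -
  \<comment> \<open>The random index set is traded for a countable infimum over all
    \<open>t\<close>, with \<infinity> at the times where the condition fails.\<close>
  have "(INF t\<in>{t. P t \<omega>}. enat t) = (INF t. if P t \<omega> then enat t else \<infinity>)" for \<omega>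
  proof (rule antisym)
    show "(INF t\<in>{t. P t \<omega>}. enat t) \<le> (INF t. if P t \<omega> then enat t else \<infinity>)"
      by (rule INF_greatest) (auto intro: INF_lower)
    show "(INF t. if P t \<omega> then enat t else \<infinity>) \<le> (INF t\<in>{t. P t \<omega>}. enat t)"
      by (rule INF_mono) auto
  qed
  moreover have "(\<lambda>\<omega>. INF t. if P t \<omega> then enat t else \<infinity>) \<in> measurable M (count_space UNIV)"
    by (intro measurable_INF measurable_If measurable_const assms) auto
  ultimately show ?thesis by simp
qed

lemma stat_Z_le_stat_S: "t \<ge> 1 \<Longrightarrow> stat_Z \<mu> d w y t \<le> stat_S \<mu> d w y t"
  unfolding stat_Z_def stat_S_def
proof (rule Max.boundedI)
  fix a assume "a \<in> (\<lambda>k. ennreal (w k) * mixture_M \<mu> d y k t) ` {1..t}"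
  then show "a \<le> (\<Sum>k=1..t. ennreal (w k) * mixture_M \<mu> d y k t)"
    by (auto simp del: atLeastAtMost_iff intro: member_le_sum[where f = "\<lambda>k. ennreal (w k) * mixture_M \<mu> d y k t"])
qed auto

lemma stat_Z_ge:
  "k \<in> {1..t} \<Longrightarrow> ennreal (w k) * mixture_M \<mu> d y k t \<le> stat_Z \<mu> d w y t"
  unfolding stat_Z_def by (intro Max_ge) auto

lemma (in density_mixture) stat_Z_measurable:
  assumes "\<And>j. j \<ge> 1 \<Longrightarrow> j \<le> t \<Longrightarrow> p j \<in> borel_measurable N" and t: "t \<ge> 1"
  shows "(\<lambda>\<omega>. stat_Z \<mu> d w (\<lambda>j. p j \<omega>) t) \<in> borel_measurable N"
  unfolding stat_Z_def using t
  by (intro borel_measurable_Max borel_measurable_times_ennreal borel_measurable_const mixture_M_measurable)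
    (use assms in auto)

text \<open>Keep only the parameters whose density is \<open>f\<close> on the unit interval. On them
  the product does not depend on the parameter as long as all \<open>y j\<close> lie in that
  interval.\<close>

lemma (in density_mixture) mixture_M_ge:
  assumes v: "mass_at \<mu> d f > 0" and y: "\<And>j. j \<in> {k..t} \<Longrightarrow> y j \<in> {0..1}"
    and f: "\<And>u. u \<in> {0..1} \<Longrightarrow> f u > 0"
  shows "ennreal (mass_at \<mu> d f * exp (\<Sum>j=k..t. ln (f (y j)))) \<le> mixture_M \<mu> d y k t"
proof -
  let ?G = "{\<theta> \<in> space \<mu>. \<forall>u\<in>{0..1}. d \<theta> u = f u}"
  \<comment> \<open>\<open>measure\<close> is 0 on sets that are not measurable, so the positive
    mass already gives measurability.\<close>
  have G: "?G \<in> sets \<mu>"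
    using v measure_notin_sets[of ?G \<mu>] unfolding mass_at_def by (rule_tac ccontr) simp
  have "ennreal (mass_at \<mu> d f * exp (\<Sum>j=k..t. ln (f (y j)))) =
      (\<Prod>j=k..t. ennreal (f (y j))) * emeasure \<mu> ?G"
  proof -
    have "exp (\<Sum>j=k..t. ln (f (y j))) = (\<Prod>j=k..t. f (y j))"
      unfolding exp_sum[OF finite_atLeastAtMost] by (intro prod.cong refl exp_ln f y)
    moreover have "(\<Prod>j=k..t. ennreal (f (y j))) = ennreal (\<Prod>j=k..t. f (y j))"
      by (intro prod_ennreal less_imp_le f y)
    moreover have "(\<Prod>j=k..t. f (y j)) \<ge> 0" by (intro prod_nonneg ballI less_imp_le f y)
    ultimately show ?thesis
      by (simp add: mass_at_def \<mu>.emeasure_eq_measure ennreal_mult[symmetric] mult.commute)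
  qed
  also have "\<dots> = (\<integral>\<^sup>+\<theta>. (\<Prod>j=k..t. ennreal (f (y j))) * indicator ?G \<theta> \<partial>\<mu>)"
    using G by (rule nn_integral_cmult_indicator[symmetric])
  also have "\<dots> \<le> mixture_M \<mu> d y k t"
    unfolding mixture_M_def
  proof (rule nn_integral_mono)
    fix \<theta>
    show "(\<Prod>j=k..t. ennreal (f (y j))) * indicator ?G \<theta> \<le> (\<Prod>j=k..t. ennreal (d \<theta> (y j)))"
    proof (cases "\<theta> \<in> ?G")
      case True
      then have "(\<Prod>j=k..t. ennreal (f (y j))) = (\<Prod>j=k..t. ennreal (d \<theta> (y j)))"
        using y by (intro prod.cong) auto
      then show ?thesis using True by simp
    qed simp
  qed
  finally show ?thesis .
qed

context changepoint_mixture
begin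

text \<open>\<open>barrier_at\<close> is the log-wealth at which the bet on \<open>f\<close> opened
  at \<open>T + 1\<close>, weighted by \<open>w (T + 1)\<close> and by the mass at \<open>f\<close>,
  equals \<open>b\<close> exactly.\<close>

lemma Z_crosses:
  assumes v: "mass_at \<mu> d f > 0" and f: "\<And>u. u \<in> {0..1} \<Longrightarrow> f u > 0"
    and y: "\<And>j. j \<in> {T+1..T+m} \<Longrightarrow> y j \<in> {0..1}" and m: "m \<ge> 1" and w: "w (T + 1) > 0"
    and growth: "barrier_at w T b (mass_at \<mu> d f) \<le> (\<Sum>j=T+1..T+m. ln (f (y j)))"
  shows "stat_Z \<mu> d w y (T + m) \<ge> ennreal b"
proof -
  let ?v = "mass_at \<mu> d f" and ?s = "\<Sum>j=T+1..T+m. ln (f (y j))"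
  have "exp (barrier_at w T b ?v) = b / w (T + 1) * (1 / ?v)"
    using v w b_pos unfolding barrier_at_def barrier_def by (simp add: exp_add)
  then have "b = w (T + 1) * (?v * exp (barrier_at w T b ?v))"
    using v w by (simp add: field_simps)
  also have "\<dots> \<le> w (T + 1) * (?v * exp ?s)"
    using growth v w by (intro mult_left_mono) auto
  finally have "ennreal b \<le> ennreal (w (T + 1)) * ennreal (?v * exp ?s)"
    using w v by (simp add: ennreal_mult[symmetric] ennreal_leI)
  also have "\<dots> \<le> ennreal (w (T + 1)) * mixture_M \<mu> d y (T + 1) (T + m)"
    by (intro mult_left_mono mixture_M_ge v y f) auto
  also have "\<dots> \<le> stat_Z \<mu> d w y (T + m)"
    using m by (intro stat_Z_ge) auto
  finally show ?thesis .
qed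

lemma tau_S_measurable: "(\<lambda>\<omega>. tau_S \<mu> d w b (\<lambda>j. p j \<omega>)) \<in> measurable M (count_space UNIV)"
  unfolding tau_S_def
proof (rule measurable_INF_enat)
  fix t
  have [measurable]: "S t \<in> borel_measurable M" by (intro stat_S_measurable p_measurable)
  show "{\<omega> \<in> space M. 1 \<le> t \<and> ennreal b \<le> S t \<omega>} \<in> sets M" by measurable
qed

lemma tau_Z_measurable: "(\<lambda>\<omega>. tau_Z \<mu> d w b (\<lambda>j. p j \<omega>)) \<in> measurable M (count_space UNIV)"
  unfolding tau_Z_def
proof (rule measurable_INF_enat)
  fix t
  show "{\<omega> \<in> space M. 1 \<le> t \<and> ennreal b \<le> stat_Z \<mu> d w (\<lambda>j. p j \<omega>) t} \<in> sets M"
  proof (cases "t \<ge> 1")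
    case True
    then have [measurable]: "(\<lambda>\<omega>. stat_Z \<mu> d w (\<lambda>j. p j \<omega>) t) \<in> borel_measurable M"
      by (intro stat_Z_measurable p_measurable)
    show ?thesis by measurable
  qed simp
qed

lemma tau_S_le_tau_Z: "tau_S \<mu> d w b y \<le> tau_Z \<mu> d w b y"
  unfolding tau_S_def tau_Z_def
proof (rule INF_superset_mono)
  show "{t. 1 \<le> t \<and> ennreal b \<le> stat_Z \<mu> d w y t} \<subseteq> {t. 1 \<le> t \<and> ennreal b \<le> stat_S \<mu> d w y t}"
    by (clarify, intro conjI order.trans[OF _ stat_Z_le_stat_S])
qed simp

lemma prob_tau_Z_le_tau_S:
  "prob {\<omega>\<in>space M. ereal_of_enat (tau_Z \<mu> d w b (\<lambda>j. p j \<omega>)) \<le> c} \<le>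
    prob {\<omega>\<in>space M. ereal_of_enat (tau_S \<mu> d w b (\<lambda>j. p j \<omega>)) \<le> c}"
proof (rule finite_measure_mono)
  have le: "ereal_of_enat (tau_S \<mu> d w b y) \<le> ereal_of_enat (tau_Z \<mu> d w b y)" for y
    by (simp add: tau_S_le_tau_Z)
  show "{\<omega>\<in>space M. ereal_of_enat (tau_Z \<mu> d w b (\<lambda>j. p j \<omega>)) \<le> c} \<subseteq>
      {\<omega>\<in>space M. ereal_of_enat (tau_S \<mu> d w b (\<lambda>j. p j \<omega>)) \<le> c}"
    by (auto intro: order.trans[OF le])
  note [measurable] = tau_S_measurable
  show "{\<omega>\<in>space M. ereal_of_enat (tau_S \<mu> d w b (\<lambda>j. p j \<omega>)) \<le> c} \<in> events" by measurable
qed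

lemma prob_tau_S_gt: "prob {\<omega>\<in>space M. enat T < tau_S \<mu> d w b (\<lambda>j. p j \<omega>)} \<ge> survival_bound w T b"
proof -
  have "enat T < tau_S \<mu> d w b y \<longleftrightarrow> not_stopped T y" for y
  proof -
    have "(\<forall>t. 1 \<le> t \<and> ennreal b \<le> F t \<longrightarrow> T < t) \<longleftrightarrow> (\<forall>t\<in>{1..T}. F t < ennreal b)"
      for F :: "nat \<Rightarrow> ennreal"
      unfolding atLeastAtMost_iff Ball_def not_le[symmetric] by blast
    then show ?thesis by (simp add: tau_S_def less_INF_enat_iff)
  qed
  then show ?thesis using prob_not_stopped_ge by simp
qed

text \<open>The smaller statistic stops later, so it inherits the survival bound of
  \<open>S\<close>.\<close>

lemma prob_tau_Z_gt: "prob {\<omega>\<in>space M. enat T < tau_Z \<mu> d w b (\<lambda>j. p j \<omega>)} \<ge> survival_bound w T b"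
proof -
  note [measurable] = tau_S_measurable tau_Z_measurable
  have "prob {\<omega>\<in>space M. enat T < tau_S \<mu> d w b (\<lambda>j. p j \<omega>)} \<le>
      prob {\<omega>\<in>space M. enat T < tau_Z \<mu> d w b (\<lambda>j. p j \<omega>)}"
    by (intro finite_measure_mono) (auto intro: less_le_trans[OF _ tau_S_le_tau_Z])
  with prob_tau_S_gt show ?thesis by linarith
qed

lemma prob_tau_Z_le_ge:
  fixes \<epsilon> c :: real
  assumes v: "mass_at \<mu> d f > 0" and f: "\<And>u. u \<in> {0..1} \<Longrightarrow> f u > 0"
    and bd: "\<And>u. u \<in> {0..1} \<Longrightarrow> \<bar>ln (f u)\<bar> \<le> B" and lip: "L-lipschitz_on {0..1} (\<lambda>u. ln (f u))"
    and B: "B > 0" and T: "T \<ge> 1" and m: "m \<ge> 1" "real m \<le> c" and \<epsilon>: "\<epsilon> > 0" and w: "w (T + 1) > 0"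
    and growth: "barrier_at w T b (mass_at \<mu> d f) \<le> m * (growth_rate f (post_H P0 P1) - \<epsilon> - L * (\<epsilon> + m / T))"
  shows "prob {\<omega>\<in>space M. ereal_of_enat (tau_Z \<mu> d w b (\<lambda>j. p j \<omega>)) \<le> ereal (T + c)}
    \<ge> 1 - 2 * real m * exp (-2 * real T * \<epsilon>\<^sup>2) - exp (- (m * \<epsilon>\<^sup>2 / (2 * B\<^sup>2)))"
proof -
  \<comment> \<open>Outside the unit interval nothing is known about \<open>f\<close>. Cutting
    \<open>ln f\<close> off there gives a Borel function on the line, by continuity on a closed
    interval.\<close>
  define g where "g u = indicat_real {0..1} u *\<^sub>R ln (f u)" for u
  have g: "g \<in> borel_measurable borel"
    unfolding g_def by (intro borel_measurable_continuous_on_indicator lipschitz_on_continuous_on[OF lip]) simp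
  have gu: "g u = ln (f u)" if "u \<in> {0..1}" for u using that by (simp add: g_def)
  have F: "cdf P0 \<in> borel_measurable borel"
    by (intro borel_measurable_mono monoI P0.cdf_nondecreasing)
  then have F1: "cdf P0 \<in> borel_measurable P1" by simp
  \<comment> \<open>\<open>post_H P0 P1\<close> is the distribution function of
    \<open>cdf P0 y\<close> for \<open>y\<close> drawn from \<open>P1\<close>, so its
    Lebesgue-Stieltjes measure is that image law, and the growth rate is a change of variables away
    from the mean in Hoeffding's inequality.\<close>
  have rate: "growth_rate f (post_H P0 P1) = (LINT y|P1. g (cdf P0 y))"
  proof -
    let ?D = "distr P1 borel (cdf P0)"
    interpret D: real_distribution ?D using F1 by (rule P1.real_distribution_distr)
    have "cdf ?D = post_H P0 P1"
      using F1 by (auto simp: fun_eq_iff cdf_def post_H_def measure_distr intro!: arg_cong[of _ _ "measure P1"])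
    moreover have "interval_measure (cdf ?D) = ?D"
    proof (rule cdf_unique)
      show "real_distribution (interval_measure (cdf ?D))"
        by (intro real_distribution_interval_measure D.cdf_nondecreasing D.cdf_is_right_cont
            D.cdf_lim_at_bot D.cdf_lim_at_top_prob)
      show "cdf (interval_measure (cdf ?D)) = cdf ?D"
        by (intro cdf_interval_measure D.cdf_nondecreasing D.cdf_is_right_cont D.cdf_lim_at_bot)
    qed unfold_locales
    ultimately have "growth_rate f (post_H P0 P1) = (LINT u|?D. g u)"
      by (simp add: growth_rate_def set_lebesgue_integral_def g_def)
    also have "\<dots> = (LINT y|P1. g (cdf P0 y))" by (rule integral_distr[OF F1 g])
    finally show ?thesis .
  qed
  have lipg: "L-lipschitz_on {0..1} g"
    using lip gu by (simp add: lipschitz_on_def)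
  let ?G = "{\<omega>\<in>space M. m * ((LINT y|P1. g (cdf P0 y)) - \<epsilon> - L * (\<epsilon> + m / T)) < (\<Sum>j=T+1..T+m. g (p j \<omega>))}"
  let ?H = "{\<omega>\<in>space M. ereal_of_enat (tau_Z \<mu> d w b (\<lambda>j. p j \<omega>)) \<le> ereal (T + c)}"
  have H: "?H \<in> sets M"
    using measurable_sets[OF tau_Z_measurable, of "{e. ereal_of_enat e \<le> ereal (T + c)}"]
    by (simp add: vimage_def Int_def conj_commute)
  have "AE \<omega> in M. \<omega> \<in> ?G \<longrightarrow> \<omega> \<in> ?H"
    using AE_p
  proof eventually_elim
    fix \<omega> assume p01: "\<forall>j\<in>{1..}. p j \<omega> \<in> {0..1}"
    have "\<omega> \<in> ?H" if \<omega>: "\<omega> \<in> ?G"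
    proof -
      have p: "p j \<omega> \<in> {0..1}" if "j \<in> {T+1..T+m}" for j using p01 that by auto
      have "(\<Sum>j=T+1..T+m. g (p j \<omega>)) = (\<Sum>j=T+1..T+m. ln (f (p j \<omega>)))"
        by (intro sum.cong refl gu p)
      with \<omega> growth have "barrier_at w T b (mass_at \<mu> d f) \<le> (\<Sum>j=T+1..T+m. ln (f (p j \<omega>)))"
        unfolding rate by simp
      from Z_crosses[OF v f p m(1) w this]
      have "\<exists>t\<in>{t. 1 \<le> t \<and> stat_Z \<mu> d w (\<lambda>j. p j \<omega>) t \<ge> ennreal b}. real t \<le> T + c"
        using m by (intro bexI[of _ "T + m"]) auto
      then have "ereal_of_enat (tau_Z \<mu> d w b (\<lambda>j. p j \<omega>)) \<le> ereal (T + c)"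
        unfolding tau_Z_def INF_enat_le_ereal_iff .
      then show ?thesis using \<omega> by simp
    qed
    then show "\<omega> \<in> ?G \<longrightarrow> \<omega> \<in> ?H" by blast
  qed
  then have "prob ?G \<le> prob ?H" using H by (intro finite_measure_mono_AE)
  moreover have "prob ?G \<ge> 1 - 2 * real m * exp (-2 * real T * \<epsilon>\<^sup>2) - exp (- (m * \<epsilon>\<^sup>2 / (2 * B\<^sup>2)))"
    using prob_log_growth_ge[OF g _ lipg B T m(1) \<epsilon>] bd gu by simp
  ultimately show ?thesis by linarith
qed

end

section \<open>From finite-sample bounds to limits\<close>

lemma conditional_detection_limits:
  fixes T :: "nat \<Rightarrow> nat" and q c :: "nat \<Rightarrow> real"
  assumes M: "\<And>n. n \<ge> 1 \<Longrightarrow> prob_space (M n)"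
    and \<tau>: "\<And>n. n \<ge> 1 \<Longrightarrow> \<tau> n \<in> measurable (M n) (count_space UNIV)"
    and det: "(\<lambda>n. \<P>(\<omega> in M n. ereal_of_enat (\<tau> n \<omega>) \<le> ereal (c n))) \<longlonglongrightarrow> 1"
    and surv: "\<And>n. n \<ge> 1 \<Longrightarrow> q n \<le> \<P>(\<omega> in M n. enat (T n) < \<tau> n \<omega>)"
    and q: "liminf (\<lambda>n. ereal (q n)) > 0"
  shows "(\<lambda>n. \<P>(\<omega> in M n. ereal_of_enat (\<tau> n \<omega>) > ereal (c n) \<bar> \<tau> n \<omega> > enat (T n))) \<longlonglongrightarrow> 0"
    and "liminf (\<lambda>n. ereal (\<P>(\<omega> in M n. enat (T n) < \<tau> n \<omega> \<and> ereal_of_enat (\<tau> n \<omega>) \<le> ereal (c n))))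
      \<ge> liminf (\<lambda>n. ereal (q n))"
proof -
  let ?a = "\<lambda>n. \<P>(\<omega> in M n. ereal_of_enat (\<tau> n \<omega>) \<le> ereal (c n))"
  let ?s = "\<lambda>n. \<P>(\<omega> in M n. enat (T n) < \<tau> n \<omega>)"
  let ?j = "\<lambda>n. \<P>(\<omega> in M n. enat (T n) < \<tau> n \<omega> \<and> ereal_of_enat (\<tau> n \<omega>) \<le> ereal (c n))"
  let ?l = "\<lambda>n. \<P>(\<omega> in M n. ereal_of_enat (\<tau> n \<omega>) > ereal (c n) \<and> \<tau> n \<omega> > enat (T n))"
  \<comment> \<open>\<open>?l\<close> is survival beyond both the change and the deadline,
    \<open>?j\<close> is survival of the change followed by timely detection. Detection alone sends
    \<open>?l\<close> to 0. With \<open>?s = ?j + ?l\<close>, dividing \<open>?l\<close> by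
    \<open>?s\<close> gives the first claim and \<open>?j \<ge> q n + ?a n - 1\<close> the
    second.\<close>
  have late: "?l n \<le> 1 - ?a n" and split: "?s n = ?j n + ?l n" if n: "n \<ge> 1" for n
  proof -
    interpret prob_space "M n" by (rule M[OF n])
    note [measurable] = \<tau>[OF n]
    have "?l n \<le> \<P>(\<omega> in M n. \<not> ereal_of_enat (\<tau> n \<omega>) \<le> ereal (c n))"
      by (intro finite_measure_mono) auto
    also have "\<dots> = 1 - ?a n" by (rule prob_neg) measurable
    finally show "?l n \<le> 1 - ?a n" .
    have "?s n = prob ({\<omega>\<in>space (M n). enat (T n) < \<tau> n \<omega> \<and> ereal_of_enat (\<tau> n \<omega>) \<le> ereal (c n)} \<union>
        {\<omega>\<in>space (M n). ereal_of_enat (\<tau> n \<omega>) > ereal (c n) \<and> \<tau> n \<omega> > enat (T n)})"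
      by (rule arg_cong[of _ _ prob]) auto
    also have "\<dots> = ?j n + ?l n" by (rule finite_measure_Union) auto
    finally show "?s n = ?j n + ?l n" .
  qed
  have a0: "(\<lambda>n. 1 - ?a n) \<longlonglongrightarrow> 0" using tendsto_diff[OF tendsto_const det, of 1] by simp
  \<comment> \<open>A positive number below the limit inferior eventually bounds the probability of
    the conditioning event away from 0.\<close>
  obtain \<delta> where \<delta>: "0 < ereal \<delta>" "ereal \<delta> < liminf (\<lambda>n. ereal (q n))"
    using ereal_dense2[OF q] by auto
  have ev: "eventually (\<lambda>n. n \<ge> 1 \<and> \<delta> < q n) sequentially"
    using less_LiminfD[OF \<delta>(2)] eventually_ge_at_top[of 1] by eventually_elim simp
  show "(\<lambda>n. \<P>(\<omega> in M n. ereal_of_enat (\<tau> n \<omega>) > ereal (c n) \<bar> \<tau> n \<omega> > enat (T n))) \<longlonglongrightarrow> 0"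
    unfolding cond_prob_def
  proof (rule tendsto_sandwich[OF _ _ tendsto_const])
    show "eventually (\<lambda>n. 0 \<le> ?l n / ?s n) sequentially" by simp
    show "eventually (\<lambda>n. ?l n / ?s n \<le> (1 - ?a n) / \<delta>) sequentially"
      using ev
    proof eventually_elim
      fix n assume n: "n \<ge> 1 \<and> \<delta> < q n"
      then show "?l n / ?s n \<le> (1 - ?a n) / \<delta>"
        using late[of n] surv[of n] \<delta>(1) order.trans[OF measure_nonneg late[of n]] by (intro frac_le) auto
    qed
    show "(\<lambda>n. (1 - ?a n) / \<delta>) \<longlonglongrightarrow> 0" using tendsto_divide[OF a0 tendsto_const, of \<delta>] \<delta>(1) by simp
  qed
  have "liminf (\<lambda>n. ereal (?a n - 1)) = 0"
  proof (rule lim_imp_Liminf)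
    show "(\<lambda>n. ereal (?a n - 1)) \<longlonglongrightarrow> 0"
      using tendsto_diff[OF det tendsto_const, of 1] by (simp add: zero_ereal_def)
  qed simp
  then have "liminf (\<lambda>n. ereal (q n)) = liminf (\<lambda>n. ereal (q n)) + liminf (\<lambda>n. ereal (?a n - 1))" by simp
  \<comment> \<open>Superadditivity of the limit inferior; since the second one is 0, opposite
    infinities cannot meet.\<close>
  also have "\<dots> \<le> liminf (\<lambda>n. ereal (q n) + ereal (?a n - 1))"
    by (rule ereal_liminf_add_mono) (simp add: \<open>liminf (\<lambda>n. ereal (?a n - 1)) = 0\<close>)
  also have "\<dots> \<le> liminf (\<lambda>n. ereal (?j n))"
  proof (rule Liminf_mono)
    show "eventually (\<lambda>n. ereal (q n) + ereal (?a n - 1) \<le> ereal (?j n)) sequentially"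
      using eventually_ge_at_top[of 1]
    proof eventually_elim
      fix n :: nat assume "n \<ge> 1"
      then show "ereal (q n) + ereal (?a n - 1) \<le> ereal (?j n)"
        using late[of n] surv[of n] split[of n] by simp
    qed
  qed
  finally show "liminf (\<lambda>n. ereal (q n)) \<le> liminf (\<lambda>n. ereal (?j n))" .
qed

text \<open>The rate \<open>I\<close> exceeds the required \<open>1 / A\<close> by a positive slack.
  Half of it pays for \<open>\<epsilon> + L * \<epsilon>\<close>, a quarter for the contamination
  term, and the last quarter for rounding \<open>A * C n\<close> down to an integer.\<close>

lemma eventually_growth_exceeds:
  fixes C :: "nat \<Rightarrow> real" and T :: "nat \<Rightarrow> nat" and A I L :: real
  assumes C: "filterlim C at_top sequentially" and CT: "C \<in> o(\<lambda>n. real (T n))"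
    and T: "filterlim T at_top sequentially" and A: "A > 0" "A * I > 1" and L: "L \<ge> 0"
  obtains \<epsilon> :: real where "\<epsilon> > 0"
    "eventually (\<lambda>n. C n \<le> real (nat \<lfloor>A * C n\<rfloor>) * (I - \<epsilon> - L * (\<epsilon> + real (nat \<lfloor>A * C n\<rfloor>) / T n))) sequentially"
    "eventually (\<lambda>n. 1 \<le> nat \<lfloor>A * C n\<rfloor> \<and> real (nat \<lfloor>A * C n\<rfloor>) \<le> A * C n \<and> nat \<lfloor>A * C n\<rfloor> \<le> T n) sequentially"
proof
  define \<kappa> where "\<kappa> = I - 1 / A"
  \<comment> \<open>With this choice \<open>\<epsilon> + L * \<epsilon>\<close> is exactly
    \<open>\<kappa> / 2\<close>, and the divisor stays positive for \<open>L = 0\<close>.\<close>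
  define \<epsilon> where "\<epsilon> = \<kappa> / (2 * (1 + L))"
  have \<kappa>: "\<kappa> > 0" using A by (simp add: \<kappa>_def field_simps)
  then show "\<epsilon> > 0" using L by (simp add: \<epsilon>_def)
  let ?m = "\<lambda>n. nat \<lfloor>A * C n\<rfloor>"
  have \<epsilon>: "I - \<epsilon> - L * \<epsilon> = 1 / A + \<kappa> / 2"
  proof -
    have "K * (\<kappa> / (2 * K)) = \<kappa> / 2" if "K > 0" for K using that by simp
    from this[of "1 + L"] have "(1 + L) * \<epsilon> = \<kappa> / 2" using L by (simp add: \<epsilon>_def)
    then have "\<epsilon> + L * \<epsilon> = \<kappa> / 2" by (simp add: distrib_right)
    moreover have "1 / A = I - \<kappa>" by (simp add: \<kappa>_def)
    ultimately show ?thesis by linarith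
  qed
  have Tpos: "eventually (\<lambda>n. T n \<ge> 1) sequentially"
    using T by (simp add: filterlim_at_top)
  have CT0: "(\<lambda>n. C n / T n) \<longlonglongrightarrow> 0" using smalloD_tendsto[OF CT] .
  have small: "eventually (\<lambda>n. C n / T n < r) sequentially" if "r > 0" for r
    using order_tendstoD(2)[OF CT0 that] .
  have big: "eventually (\<lambda>n. C n \<ge> r) sequentially" for r
    using C by (simp add: filterlim_at_top)
  have "1 / A > 0" "\<kappa> / (4 * A * (1 + L)) > 0" using A \<kappa> L by simp_all
  note small = this[THEN small]
  show "eventually (\<lambda>n. 1 \<le> ?m n \<and> real (?m n) \<le> A * C n \<and> ?m n \<le> T n) sequentially"
    using big[of "1 / A"] small(1) Tpos
  proof eventually_elim
    fix n assume n: "C n \<ge> 1 / A" "C n / T n < 1 / A" "T n \<ge> 1"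
    have "A * C n \<ge> 1" "A * C n < T n" using n A by (auto simp: field_simps)
    then show "1 \<le> ?m n \<and> real (?m n) \<le> A * C n \<and> ?m n \<le> T n" by linarith
  qed
  show "eventually (\<lambda>n. C n \<le> real (?m n) * (I - \<epsilon> - L * (\<epsilon> + real (?m n) / T n))) sequentially"
    \<comment> \<open>The second threshold is where
      \<open>(A * C n - 1) * (1 / A + \<kappa> / 4)\<close> overtakes \<open>C n\<close>, which
      absorbs the rounding. \<open>small(2)\<close> keeps \<open>L\<close> times the window over
      \<open>T n\<close> below \<open>\<kappa> / 4\<close>.\<close>
    using big[of "1 / A"] big[of "(1 / A + \<kappa> / 4) / (A * \<kappa> / 4)"] small(2) Tpos
  proof eventually_elim
    fix n assume n: "C n \<ge> 1 / A" "C n \<ge> (1 / A + \<kappa> / 4) / (A * \<kappa> / 4)"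
      "C n / T n < \<kappa> / (4 * A * (1 + L))" "T n \<ge> 1"
    have AC: "A * C n \<ge> 1" using n A by (simp add: field_simps)
    then have m: "real (?m n) \<le> A * C n" "real (?m n) \<ge> A * C n - 1" by linarith+
    have "L * (real (?m n) / T n) \<le> (1 + L) * (A * C n / T n)"
      using m L n AC by (intro mult_mono divide_right_mono) auto
    also have "\<dots> = (1 + L) * A * (C n / T n)" by simp
    also have "\<dots> \<le> (1 + L) * A * (\<kappa> / (4 * A * (1 + L)))"
      using n(3) A L by (intro mult_left_mono) auto
    also have "\<dots> = \<kappa> / 4"
    proof -
      have "K * A * (\<kappa> / (4 * A * K)) = \<kappa> / 4" if "K > 0" for K using that A by simp
      from this[of "1 + L"] show ?thesis using L by simp
    qed
    finally have r: "1 / A + \<kappa> / 4 \<le> I - \<epsilon> - L * (\<epsilon> + real (?m n) / T n)"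
      using \<epsilon> unfolding distrib_left by linarith
    have "1 / A + \<kappa> / 4 \<le> C n * (A * \<kappa> / 4)" using n(2) A \<kappa> by (simp add: pos_divide_le_eq)
    then have "C n \<le> (A * C n - 1) * (1 / A + \<kappa> / 4)" using A by (simp add: algebra_simps)
    also have "\<dots> \<le> real (?m n) * (1 / A + \<kappa> / 4)" using m A \<kappa> by (intro mult_right_mono) auto
    also have "\<dots> \<le> real (?m n) * (I - \<epsilon> - L * (\<epsilon> + real (?m n) / T n))" using r by (intro mult_left_mono) auto
    finally show "C n \<le> real (?m n) * (I - \<epsilon> - L * (\<epsilon> + real (?m n) / T n))" .
  qed
qed

text \<open>\<open>m \<le> T\<close> bounds the union term by a linear factor times an exponential
  in the same \<open>T\<close>; the other term vanishes because the window itself grows.\<close>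

lemma error_terms_tendsto:
  fixes m T :: "nat \<Rightarrow> nat" and \<epsilon> B :: real
  assumes T: "filterlim T at_top sequentially" and m: "filterlim m at_top sequentially"
    and mT: "eventually (\<lambda>n. m n \<le> T n) sequentially" and \<epsilon>: "\<epsilon> > 0" and B: "B > 0"
  shows "(\<lambda>n. 1 - 2 * real (m n) * exp (-2 * real (T n) * \<epsilon>\<^sup>2) - exp (- (m n * \<epsilon>\<^sup>2 / (2 * B\<^sup>2)))) \<longlonglongrightarrow> 1"
proof -
  have Tr: "filterlim (\<lambda>n. 2 * \<epsilon>\<^sup>2 * real (T n)) at_top sequentially"
    using \<epsilon> by (intro filterlim_tendsto_pos_mult_at_top[OF tendsto_const]
        filterlim_compose[OF filterlim_real_sequentially T]) auto
  have "(\<lambda>n. 1 / \<epsilon>\<^sup>2 * ((2 * \<epsilon>\<^sup>2 * real (T n)) ^ 1 / exp (2 * \<epsilon>\<^sup>2 * real (T n)))) \<longlonglongrightarrow> 1 / \<epsilon>\<^sup>2 * 0"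
    by (intro tendsto_mult tendsto_const filterlim_compose[OF tendsto_power_div_exp_0 Tr])
  moreover have "1 / \<epsilon>\<^sup>2 * ((2 * \<epsilon>\<^sup>2 * real (T n)) ^ 1 / exp (2 * \<epsilon>\<^sup>2 * real (T n))) =
      2 * real (T n) * exp (-2 * real (T n) * \<epsilon>\<^sup>2)" for n
    using \<epsilon> by (simp add: exp_minus field_simps)
  ultimately have T0: "(\<lambda>n. 2 * real (T n) * exp (-2 * real (T n) * \<epsilon>\<^sup>2)) \<longlonglongrightarrow> 0" by simp
  have 1: "(\<lambda>n. 2 * real (m n) * exp (-2 * real (T n) * \<epsilon>\<^sup>2)) \<longlonglongrightarrow> 0"
  proof (rule tendsto_sandwich[OF _ _ tendsto_const T0])
    show "eventually (\<lambda>n. 2 * real (m n) * exp (-2 * real (T n) * \<epsilon>\<^sup>2) \<le> 2 * real (T n) * exp (-2 * real (T n) * \<epsilon>\<^sup>2)) sequentially"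
      using mT by eventually_elim simp
  qed simp
  have "filterlim (\<lambda>n. \<epsilon>\<^sup>2 / (2 * B\<^sup>2) * real (m n)) at_top sequentially"
    using \<epsilon> B by (intro filterlim_tendsto_pos_mult_at_top[OF tendsto_const]
        filterlim_compose[OF filterlim_real_sequentially m]) auto
  then have "(\<lambda>n. exp (- (\<epsilon>\<^sup>2 / (2 * B\<^sup>2) * real (m n)))) \<longlonglongrightarrow> 0"
    by (intro filterlim_compose[OF exp_at_bot] filterlim_compose[OF filterlim_uminus_at_bot_at_top])
  then have 2: "(\<lambda>n. exp (- (m n * \<epsilon>\<^sup>2 / (2 * B\<^sup>2)))) \<longlonglongrightarrow> 0" by (simp add: mult.commute)
  show ?thesis using tendsto_diff[OF tendsto_diff[OF tendsto_const 1] 2, of 1] by simp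
qed

theorem theorem4p11:
  fixes T :: "nat \<Rightarrow> nat"
    and P0 P1 :: "real measure"
    and M :: "nat \<Rightarrow> 'a measure"
    and X U :: "nat \<Rightarrow> nat \<Rightarrow> 'a \<Rightarrow> real"
    and \<mu> :: "'b measure"
    and d :: "'b \<Rightarrow> real \<Rightarrow> real"
    and w b :: "nat \<Rightarrow> real"
    and f :: "real \<Rightarrow> real"
    and v A :: real
    and p :: "nat \<Rightarrow> 'a \<Rightarrow> nat \<Rightarrow> real"
    and H :: "real \<Rightarrow> real"
    and C q :: "nat \<Rightarrow> real"
  assumes T_pos: "\<And>n. n \<ge> 1 \<Longrightarrow> T n \<ge> 1"
    and T_mono: "mono_on {1..} T"
    and T_lim: "filterlim T at_top sequentially"
    and P0: "real_distribution P0"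
    and P1: "real_distribution P1"
    and rows: "\<And>n. n \<ge> 1 \<Longrightarrow> changepoint_row (M n) P0 (T n) P1 (X n) (U n)"
    and p_def: "\<And>n \<omega>. p n \<omega> = conformal_p (\<lambda>j. X n j \<omega>) (\<lambda>j. U n j \<omega>)"
    and family: "density_family \<mu> d"
    and w_nonneg: "\<And>k. k \<ge> 1 \<Longrightarrow> w k \<ge> 0"
    and b_pos: "\<And>n. n \<ge> 1 \<Longrightarrow> b n > 0"
    and H_def: "H = post_H P0 P1"
    and cdf_cont: "continuous_on UNIV (cdf P0)"
    and H_cont: "continuous_on {0..1} H"
    and H_0: "H 0 = 0"
    and H_sep: "(SUP t\<in>{0..1}. \<bar>H t - t\<bar>) > 0"
    and w_change: "\<And>n. n \<ge> 1 \<Longrightarrow> w (T n + 1) > 0"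
    and v_def: "v = mass_at \<mu> d f"
    and v_pos: "v > 0"
    and f_pos: "\<And>u. u \<in> {0..1} \<Longrightarrow> f u > 0"
    and ln_f_bounded: "bounded ((\<lambda>u. ln (f u)) ` {0..1})"
    and ln_f_Lipschitz: "\<exists>L. L-lipschitz_on {0..1} (\<lambda>u. ln (f u))"
    and rate_pos: "growth_rate f H > 0"
    and C_def: "\<And>n. C n = barrier_at w (T n) (b n) v"
    and C_lim: "filterlim C at_top sequentially"
    and C_small: "C \<in> o(\<lambda>n. real (T n))"
    and q_def: "\<And>n. q n = survival_bound w (T n) (b n)"
    and A: "A > 1 / growth_rate f H"
  shows
    "((\<lambda>n. \<P>(\<omega> in M n. ereal_of_enat (tau_S \<mu> d w (b n) (p n \<omega>))
            \<le> ereal (real (T n) + A * C n))) \<longlonglongrightarrow> 1)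
     \<and> ((\<lambda>n. \<P>(\<omega> in M n. ereal_of_enat (tau_Z \<mu> d w (b n) (p n \<omega>))
            \<le> ereal (real (T n) + A * C n))) \<longlonglongrightarrow> 1)
     \<and> (liminf (\<lambda>n. ereal (q n)) > 0 \<longrightarrow>
         ((\<lambda>n. \<P>(\<omega> in M n. ereal_of_enat (tau_Z \<mu> d w (b n) (p n \<omega>))
                > ereal (real (T n) + A * C n)
              \<bar> tau_Z \<mu> d w (b n) (p n \<omega>) > enat (T n))) \<longlonglongrightarrow> 0)
         \<and> liminf (\<lambda>n. ereal (\<P>(\<omega> in M n. enat (T n) < tau_Z \<mu> d w (b n) (p n \<omega>)
                \<and> ereal_of_enat (tau_Z \<mu> d w (b n) (p n \<omega>)) \<le> ereal (real (T n) + A * C n))))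
             \<ge> liminf (\<lambda>n. ereal (q n))
         \<and> ((\<lambda>n. \<P>(\<omega> in M n. ereal_of_enat (tau_S \<mu> d w (b n) (p n \<omega>))
                > ereal (real (T n) + A * C n)
              \<bar> tau_S \<mu> d w (b n) (p n \<omega>) > enat (T n))) \<longlonglongrightarrow> 0)
         \<and> liminf (\<lambda>n. ereal (\<P>(\<omega> in M n. enat (T n) < tau_S \<mu> d w (b n) (p n \<omega>)
                \<and> ereal_of_enat (tau_S \<mu> d w (b n) (p n \<omega>)) \<le> ereal (real (T n) + A * C n))))
             \<ge> liminf (\<lambda>n. ereal (q n)))"
proof -
  let ?I = "growth_rate f H"
  obtain B where B: "B > 0" "\<And>u. u \<in> {0..1} \<Longrightarrow> \<bar>ln (f u)\<bar> \<le> B"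
    using ln_f_bounded by (auto simp: bounded_pos)
  obtain L where L: "L-lipschitz_on {0..1} (\<lambda>u. ln (f u))" using ln_f_Lipschitz by blast
  have L0: "L \<ge> 0" using L by (rule lipschitz_on_nonneg)
  have A0: "A > 0" using A rate_pos by (meson less_trans zero_less_divide_1_iff)
  have AI: "A * ?I > 1" using A rate_pos by (simp add: divide_less_eq)
  have row: "changepoint_mixture P0 P1 (M n) (T n) (X n) (U n) \<mu> d w (b n)" if n: "n \<ge> 1" for n
  proof -
    interpret P0: real_distribution P0 by (rule P0)
    have "emeasure P0 {x} = 0" for x
    proof -
      \<comment> \<open>A continuity point of a distribution function carries no mass; this is how
        continuity of \<open>cdf P0\<close> enters.\<close>
      have "isCont (cdf P0) x" using cdf_cont by (simp add: continuous_on_eq_continuous_at)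
      then show ?thesis by (simp add: P0.isCont_cdf P0.emeasure_eq_measure)
    qed
    moreover have "prob_space (M n)" using rows[OF n] by (simp add: changepoint_row_def)
    ultimately show ?thesis
      using P0 P1 rows[OF n] family w_nonneg b_pos[OF n]
      by (simp add: changepoint_mixture_def changepoint_mixture_axioms_def changepoint_def
          changepoint_axioms_def atomless_distribution_def atomless_distribution_axioms_def density_mixture_def)
  qed
  have p_eq: "p n \<omega> = (\<lambda>j. conformal_p (\<lambda>j. X n j \<omega>) (\<lambda>j. U n j \<omega>) j)" for n \<omega>
    by (simp add: p_def)
  obtain \<epsilon> where \<epsilon>: "\<epsilon> > 0"
    and growth: "eventually (\<lambda>n. C n \<le> real (nat \<lfloor>A * C n\<rfloor>) * (?I - \<epsilon> - L * (\<epsilon> + real (nat \<lfloor>A * C n\<rfloor>) / T n))) sequentially"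
    and window: "eventually (\<lambda>n. 1 \<le> nat \<lfloor>A * C n\<rfloor> \<and> real (nat \<lfloor>A * C n\<rfloor>) \<le> A * C n \<and> nat \<lfloor>A * C n\<rfloor> \<le> T n) sequentially"
    by (rule eventually_growth_exceeds[OF C_lim C_small T_lim A0 AI L0])
  \<comment> \<open>The number of whole steps before the deadline. \<open>nat\<close> turns a
    negative floor into 0, which can happen for finitely many \<open>n\<close> only, as
    \<open>C\<close> tends to infinity.\<close>
  define m where "m n = nat \<lfloor>A * C n\<rfloor>" for n
  have m_lim: "filterlim m at_top sequentially"
    unfolding filterlim_at_top
  proof
    fix Z
    have "eventually (\<lambda>n. real Z / A \<le> C n) sequentially" using C_lim by (simp add: filterlim_at_top)
    then show "eventually (\<lambda>n. Z \<le> m n) sequentially"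
      by eventually_elim (use A0 in \<open>simp add: m_def field_simps le_nat_floor\<close>)
  qed
  have mT: "eventually (\<lambda>n. m n \<le> T n) sequentially"
    using window by eventually_elim (simp add: m_def)
  let ?r = "\<lambda>n. 1 - 2 * real (m n) * exp (-2 * real (T n) * \<epsilon>\<^sup>2) - exp (- (m n * \<epsilon>\<^sup>2 / (2 * B\<^sup>2)))"
  have r: "?r \<longlonglongrightarrow> 1" by (rule error_terms_tendsto[OF T_lim m_lim mT \<epsilon> B(1)])
  let ?PZ = "\<lambda>n. \<P>(\<omega> in M n. ereal_of_enat (tau_Z \<mu> d w (b n) (p n \<omega>)) \<le> ereal (real (T n) + A * C n))"
  let ?PS = "\<lambda>n. \<P>(\<omega> in M n. ereal_of_enat (tau_S \<mu> d w (b n) (p n \<omega>)) \<le> ereal (real (T n) + A * C n))"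
  \<comment> \<open>One chain serves both statistics: the lower bound is proved for
    \<open>Z\<close>, and \<open>S\<close> is then squeezed between \<open>Z\<close> and 1.\<close>
  have "eventually (\<lambda>n. ?r n \<le> ?PZ n \<and> ?PZ n \<le> ?PS n \<and> ?PS n \<le> 1) sequentially"
    using growth window eventually_ge_at_top[of 1]
  proof eventually_elim
    fix n :: nat
    assume growth: "C n \<le> real (nat \<lfloor>A * C n\<rfloor>) * (?I - \<epsilon> - L * (\<epsilon> + real (nat \<lfloor>A * C n\<rfloor>) / T n))"
      and window: "1 \<le> nat \<lfloor>A * C n\<rfloor> \<and> real (nat \<lfloor>A * C n\<rfloor>) \<le> A * C n \<and> nat \<lfloor>A * C n\<rfloor> \<le> T n"
      and n: "1 \<le> n"
    interpret R: changepoint_mixture P0 P1 "M n" "T n" "X n" "U n" \<mu> d w "b n" by (rule row[OF n])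
    have "?r n \<le> ?PZ n"
      unfolding p_eq
      by (rule R.prob_tau_Z_le_ge[OF _ f_pos B(2) L B(1) T_pos[OF n] _ _ \<epsilon> w_change[OF n]])
        (use growth window v_pos C_def[of n] H_def v_def in \<open>simp_all add: m_def\<close>)
    moreover have "?PZ n \<le> ?PS n" unfolding p_eq by (rule R.prob_tau_Z_le_tau_S)
    ultimately show "?r n \<le> ?PZ n \<and> ?PZ n \<le> ?PS n \<and> ?PS n \<le> 1" by (simp add: R.prob_le_1)
  qed
  then have ev: "eventually (\<lambda>n. ?r n \<le> ?PZ n) sequentially" "eventually (\<lambda>n. ?PZ n \<le> 1) sequentially"
    "eventually (\<lambda>n. ?PZ n \<le> ?PS n) sequentially" "eventually (\<lambda>n. ?PS n \<le> 1) sequentially"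
    by (auto elim: eventually_mono)
  have Z: "?PZ \<longlonglongrightarrow> 1" by (rule tendsto_sandwich[OF ev(1,2) r tendsto_const])
  have S: "?PS \<longlonglongrightarrow> 1" by (rule tendsto_sandwich[OF ev(3,4) Z tendsto_const])
  have M: "prob_space (M n)" if "n \<ge> 1" for n using rows[OF that] by (simp add: changepoint_row_def)
  have meas: "(\<lambda>\<omega>. tau_Z \<mu> d w (b n) (p n \<omega>)) \<in> measurable (M n) (count_space UNIV)"
      "(\<lambda>\<omega>. tau_S \<mu> d w (b n) (p n \<omega>)) \<in> measurable (M n) (count_space UNIV)"
    and surv: "q n \<le> \<P>(\<omega> in M n. enat (T n) < tau_Z \<mu> d w (b n) (p n \<omega>))"
      "q n \<le> \<P>(\<omega> in M n. enat (T n) < tau_S \<mu> d w (b n) (p n \<omega>))"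
    if n: "n \<ge> 1" for n
  proof -
    interpret R: changepoint_mixture P0 P1 "M n" "T n" "X n" "U n" \<mu> d w "b n" by (rule row[OF n])
    show "(\<lambda>\<omega>. tau_Z \<mu> d w (b n) (p n \<omega>)) \<in> measurable (M n) (count_space UNIV)"
      "(\<lambda>\<omega>. tau_S \<mu> d w (b n) (p n \<omega>)) \<in> measurable (M n) (count_space UNIV)"
      unfolding p_eq by (rule R.tau_Z_measurable R.tau_S_measurable)+
    show "q n \<le> \<P>(\<omega> in M n. enat (T n) < tau_Z \<mu> d w (b n) (p n \<omega>))"
      "q n \<le> \<P>(\<omega> in M n. enat (T n) < tau_S \<mu> d w (b n) (p n \<omega>))"
      unfolding p_eq q_def by (rule R.prob_tau_Z_gt R.prob_tau_S_gt)+
  qed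
  show ?thesis
    using S Z conditional_detection_limits[OF M meas(1) Z surv(1)] conditional_detection_limits[OF M meas(2) S surv(2)]
    by (intro conjI impI) auto
qed

end
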